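(* For any positive number $\alpha$ put \[ \gamma_\alpha=\frac{6H_\alpha''(-c_\alpha)}{H_\alpha'''(-c_\alpha)}. \] Then $\gamma_\alpha>0$, and: (i) $v_\alpha(x)\sim\gamma_\alpha^{1/2}(x+c_\alpha)^{1/2}$ as $x\downarrow-c_\alpha$. (ii) $\displaystyle\lim_{x\downarrow-c_\alpha}\frac{P_\alpha(x)-s_\alpha}{x+c_\alpha}=-\tfrac12\gamma_\alpha H_\alpha''(-c_\alpha)>0$. (iii) $f_\alpha(\xi)\sim\dfrac{\sqrt2}{\pi c_\alpha\sqrt{s_\alpha-c_\alpha^2}}\,(\xi-s_\alpha)^{1/2}$ as $\xi\downarrow s_\alpha$.
   Context: Notation: $g(x)\sim h(x)$ as $x\to a$ (here from the right) means $\lim\frac{g(x)}{h(x)}=1$. For $\alpha>0$ the free Gamma distribution $\nu_\alpha=\Lambda(\mu_\alpha)$ is the image under the Bercovici–Pata bijection $\Lambda$ of the classical Gamma distribution $\mu_\alpha(dt)=\frac1{\Gamma(\alpha)}t^{\alpha-1}e^{-t}1_{[0,\infty)}(t)\,dt$. ($\Lambda$ sends the $*$-infinitely divisible law with Lévy–Khintchine triplet $(a,\rho,\eta)$ to the law, infinitely divisible for free additive convolution, whose free cumulant transform $\mathcal{C}(z)=zG^{\langle-1\rangle}(z)-1$, with $G$ the Cauchy transform, equals $\eta z+az^2+\int_{\mathbb{R}}(\frac1{1-tz}-1-tz1_{[-1,1]}(t))\,\rho(dt)$.) The measure $\nu_\alpha$ is absolutely continuous, and its density $f_\alpha$ is the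 following function. For $z\in\mathbb{C}\setminus[0,\infty)$ put $H_\alpha(z)=z+\alpha+\alpha\int_0^\infty\frac{te^{-t}}{z-t}\,dt$ and $F(z)=\int_0^\infty\frac{te^{-t}}{|z-t|^2}\,dt$. $c_\alpha$ is the unique positive number with $F(-c_\alpha)=\frac1\alpha$. $v_\alpha\colon\mathbb{R}\to[0,\infty)$ is given by $v_\alpha(x)=0$ for $x\le-c_\alpha$, and for $x>-c_\alpha$, $v_\alpha(x)$ is the unique $y>0$ with $F(x+\mathrm{i}y)=\frac1\alpha$. Then $H_\alpha(x+\mathrm{i}v_\alpha(x))\in\mathbb{R}$ for all $x\in\mathbb{R}$, and $P_\alpha(x)=H_\alpha(x+\mathrm{i}v_\alpha(x))$ defines a strictly increasing bijection $P_\alpha\colon\mathbb{R}\to\mathbb{R}$ with inverse $P_\alpha^{\langle-1\rangle}$. Put $s_\alpha=P_\alpha(-c_\alpha)=H_\alpha(-c_\alpha)$ and $Q_\alpha(x)=\frac{v_\alpha(x)}{x^2+v_\alpha(x)^2}$. Then $f_\alpha(\xi)=0$ for $\xi\le s_\alpha$ and $f_\alpha(\xi)=\frac1\pi Q_\alpha(P_\alpha^{\langle-1\rangle}(\xi))$ for $\xi>s_\alpha$. *)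

theory Defs
  imports "HOL-Analysis.Analysis" "HOL-Library.Landau_Symbols"
begin

(* The formulas below are meant for z outside the half-line [0, \<infinity>), where both integrands
   are Lebesgue integrable; the values elsewhere are never used. *)

definition free_gamma_H :: "real \<Rightarrow> complex \<Rightarrow> complex" where
  "free_gamma_H \<alpha> z = z + of_real \<alpha> + of_real \<alpha> *
     (LINT t:{0..}|lborel. complex_of_real (t * exp (- t)) / (z - complex_of_real t))"

definition free_gamma_F :: "complex \<Rightarrow> real" where
  "free_gamma_F z = (LINT t:{0..}|lborel. t * exp (- t) / (cmod (z - complex_of_real t))\<^sup>2)"

definition free_gamma_c :: "real \<Rightarrow> real" where
  "free_gamma_c \<alpha> = (THE c. c > 0 \<and> free_gamma_F (- complex_of_real c) = 1 / \<alpha>)"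

definition free_gamma_v :: "real \<Rightarrow> real \<Rightarrow> real" where
  "free_gamma_v \<alpha> x =
     (if x \<le> - free_gamma_c \<alpha> then 0
      else (THE y. y > 0 \<and> free_gamma_F (Complex x y) = 1 / \<alpha>))"

(* H is real on the graph of v, because Im (H (x + i y)) = y * (1 - \<alpha> * F (x + i y));
   Re is only the coercion back to the reals. *)
definition free_gamma_P :: "real \<Rightarrow> real \<Rightarrow> real" where
  "free_gamma_P \<alpha> x = Re (free_gamma_H \<alpha> (Complex x (free_gamma_v \<alpha> x)))"

definition free_gamma_s :: "real \<Rightarrow> real" where
  "free_gamma_s \<alpha> = free_gamma_P \<alpha> (- free_gamma_c \<alpha>)"

definition free_gamma_Q :: "real \<Rightarrow> real \<Rightarrow> real" where
  "free_gamma_Q \<alpha> x = free_gamma_v \<alpha> x / (x\<^sup>2 + (free_gamma_v \<alpha> x)\<^sup>2)"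

(* The density of the free Gamma distribution, the image of the Gamma distribution with
   parameter \<alpha> under the Bercovici-Pata bijection. P is a bijection of the reals, so inv is its
   inverse function. *)
definition free_gamma_density :: "real \<Rightarrow> real \<Rightarrow> real" where
  "free_gamma_density \<alpha> \<xi> =
     (if \<xi> \<le> free_gamma_s \<alpha> then 0
      else 1 / pi * free_gamma_Q \<alpha> (inv (free_gamma_P \<alpha>) \<xi>))"

definition free_gamma_DH :: "nat \<Rightarrow> real \<Rightarrow> complex" where
  "free_gamma_DH n \<alpha> = (deriv ^^ n) (free_gamma_H \<alpha>) (- complex_of_real (free_gamma_c \<alpha>))"

(* The derivatives of H at the point -c of the real line are real numbers; Re is only the
   coercion. *)
definition free_gamma_gamma :: "real \<Rightarrow> real" where
  "free_gamma_gamma \<alpha> = Re (6 * free_gamma_DH 2 \<alpha> / free_gamma_DH 3 \<alpha>)"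

end

theory Submission
  imports Defs "HOL-Probability.Distributions" "HOL-Real_Asymp.Real_Asymp"
begin

text \<open>
  Near its left edge the free Gamma density is a square root because \<open>H\<close> has a simple critical
  point at \<open>- c\<close>. Both \<open>H\<close> and \<open>F\<close> are integrals against the probability
  measure \<open>t exp (- t) dt\<close> on the half-line, which is the Gamma distribution with parameter \<open>2\<close>.
  With \<open>M\<^sub>k\<close> the integral of \<open>1 / (c + t) ^ k\<close> against it, the equation for \<open>c\<close> reads
  \<open>\<alpha> M\<^sub>2 = 1\<close>; the derivatives of \<open>H\<close> at \<open>- c\<close> are \<open>0\<close>, \<open>- 2 \<alpha> M\<^sub>3\<close> and
  \<open>- 6 \<alpha> M\<^sub>4\<close>, and hence \<open>\<gamma> = 2 M\<^sub>3 / M\<^sub>4\<close>.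

  Two exact expansions replace Taylor's formula with its error terms. For \<open>z = x + \<i> v x\<close> on the
  boundary curve and \<open>u = x + c\<close>, the equation \<open>F z = F (- c)\<close> becomes
  \<open>2 u A z = (u\<^sup>2 + v\<^sup>2) B z\<close> (lemma \<open>free_gamma_F_expansion\<close>), where \<open>A\<close> and \<open>B\<close> are
  continuous at \<open>- c\<close> with values \<open>M\<^sub>3\<close> and \<open>M\<^sub>4\<close>. So \<open>v\<^sup>2 / u\<close> tends to
  \<open>\<gamma>\<close>. Similarly \<open>H z - H (- c) = \<alpha> (z + c)\<^sup>2 J z\<close> with \<open>J\<close> continuous at \<open>- c\<close>, of value
  \<open>- M\<^sub>3\<close> (lemma \<open>free_gamma_H_expansion\<close>). Since \<open>(z + c)\<^sup>2 / u\<close> tends to \<open>- \<gamma>\<close>, the slope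
  of \<open>P\<close> at the edge is \<open>\<alpha> \<gamma> M\<^sub>3\<close>.

  For the density, the two limits combine to the constant \<open>1 / (\<pi> c\<^sup>2 sqrt (\<alpha> M\<^sub>3))\<close>, and
  integration by parts gives \<open>s - c\<^sup>2 = 2 c\<^sup>2 \<alpha> M\<^sub>3\<close> (lemmas \<open>inverse_moment_relation\<close> and
  \<open>free_gamma_s_minus_c_squared\<close>). What has to be known about the inverse of \<open>P\<close> is that it takes
  right neighbourhoods of \<open>s\<close> to right neighbourhoods of \<open>- c\<close>. This follows from the continuity
  of \<open>P\<close> on \<open>[- c, \<infinity>)\<close> and from the strict monotonicity of \<open>P\<close> on the whole real line,
  which holds since \<open>(H z - H w) / (z - w)\<close> has positive real part for distinct points \<open>z\<close>, \<open>w\<close> of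
  the curve (lemmas \<open>Re_integral_kernel_product_less\<close> and \<open>strict_mono_free_gamma_P\<close>).
\<close>

section \<open>The Gamma distribution with parameter 2\<close>

definition gamma_two :: "real measure" where
  "gamma_two = density lborel (erlang_density 1 1)"

interpretation gamma_two: prob_space gamma_two
  unfolding gamma_two_def by (rule prob_space_erlang_density) simp

lemma sets_gamma_two [measurable_cong]: "sets gamma_two = sets borel"
  by (simp add: gamma_two_def)

lemma space_gamma_two [simp]: "space gamma_two = UNIV"
  by (simp add: gamma_two_def)

lemma erlang_density_1_1: "erlang_density 1 1 t = indicator {0..} t * (t * exp (- t))"
  by (auto simp: erlang_density_def indicator_def)

lemma AE_gamma_two_nonneg: "AE t in gamma_two. 0 \<le> t"
  unfolding gamma_two_def by (subst AE_density) (auto simp: erlang_density_def)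

lemma integral_gamma_two:
  fixes f :: "real \<Rightarrow> 'b::{banach, second_countable_topology}"
  assumes "f \<in> borel_measurable borel"
  shows "(LINT t|gamma_two. f t) = (LINT t:{0..}|lborel. (t * exp (- t)) *\<^sub>R f t)"
proof -
  have "(LINT t|gamma_two. f t) = (LINT t|lborel. erlang_density 1 1 t *\<^sub>R f t)"
    unfolding gamma_two_def using assms
    by (intro integral_density) (auto simp: erlang_density_nonneg)
  then show ?thesis
    unfolding set_lebesgue_integral_def erlang_density_1_1 by (simp add: scaleR_scaleR)
qed

lemma integrable_gamma_two:
  fixes f :: "real \<Rightarrow> 'b::{banach, second_countable_topology}"
  assumes "f \<in> borel_measurable borel" and "\<And>t. t \<ge> 0 \<Longrightarrow> norm (f t) \<le> B"
  shows "integrable gamma_two f"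
proof (rule gamma_two.integrable_const_bound)
  show "AE t in gamma_two. norm (f t) \<le> B"
    using AE_gamma_two_nonneg by eventually_elim (rule assms)
  show "f \<in> borel_measurable gamma_two"
    using assms(1) measurable_cong_sets[OF sets_gamma_two refl] by blast
qed

lemma integral_gamma_two_strict_mono:
  fixes f g :: "real \<Rightarrow> real"
  assumes "integrable gamma_two f" "integrable gamma_two g" and "\<And>t. t \<ge> 0 \<Longrightarrow> f t < g t"
  shows "(LINT t|gamma_two. f t) < (LINT t|gamma_two. g t)"
proof (rule gamma_two.integral_less_AE_space[OF assms(1,2)])
  show "AE t in gamma_two. f t < g t"
    using AE_gamma_two_nonneg by eventually_elim (rule assms)
  show "emeasure gamma_two (space gamma_two) \<noteq> 0"
    by (simp only: gamma_two.emeasure_space_1) simp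
qed

text \<open>
  Dominated convergence: the measure is finite, so a constant serves as the dominating function.
\<close>

lemma isCont_integral_gamma_two:
  fixes f :: "complex \<Rightarrow> real \<Rightarrow> 'b::{banach, second_countable_topology}"
  assumes meas: "\<And>w. f w \<in> borel_measurable borel"
    and cont: "\<And>t. t \<ge> 0 \<Longrightarrow> isCont (\<lambda>w. f w t) z"
    and bound: "\<forall>\<^sub>F w in nhds z. \<forall>t\<ge>0. norm (f w t) \<le> B"
  shows "isCont (\<lambda>w. LINT t|gamma_two. f w t) z"
proof -
  obtain S where S: "open S" "z \<in> S" "\<And>w t. w \<in> S \<Longrightarrow> t \<ge> 0 \<Longrightarrow> norm (f w t) \<le> B"
    using bound unfolding eventually_nhds by blast
  have "((\<lambda>w. LINT t|gamma_two. f w t) \<longlongrightarrow> (LINT t|gamma_two. f z t)) (at z within S)"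
    unfolding tendsto_at_iff_sequentially
  proof (intro allI impI)
    fix X :: "nat \<Rightarrow> complex"
    assume X: "\<forall>i. X i \<in> S - {z}" "X \<longlonglongrightarrow> z"
    have meas': "f w \<in> borel_measurable gamma_two" for w
      using meas measurable_cong_sets[OF sets_gamma_two refl] by blast
    show "((\<lambda>w. LINT t|gamma_two. f w t) \<circ> X) \<longlonglongrightarrow> (LINT t|gamma_two. f z t)"
      unfolding o_def
    proof (rule integral_dominated_convergence[where w = "\<lambda>_. B"])
      show "AE t in gamma_two. (\<lambda>i. f (X i) t) \<longlonglongrightarrow> f z t"
        using AE_gamma_two_nonneg
        by eventually_elim (rule isCont_tendsto_compose[OF cont X(2)])
      show "AE t in gamma_two. norm (f (X i) t) \<le> B" for i
        using AE_gamma_two_nonneg by eventually_elim (use X S in auto)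
    qed (use meas' in auto)
  qed
  then show ?thesis
    unfolding isCont_def by (simp add: at_within_open[OF S(2,1)])
qed

section \<open>The Cauchy kernel off the half-line\<close>

definition cauchy_kernel :: "complex \<Rightarrow> real \<Rightarrow> complex" where
  "cauchy_kernel z t = 1 / (z - complex_of_real t)"

lemma cauchy_kernel_measurable [measurable]: "cauchy_kernel z \<in> borel_measurable borel"
  unfolding cauchy_kernel_def by measurable

lemma off_nonneg_Reals_iff: "z \<notin> \<real>\<^sub>\<ge>\<^sub>0 \<longleftrightarrow> Im z \<noteq> 0 \<or> Re z < 0"
  by (auto simp: complex_nonneg_Reals_iff)

lemma neg_real_off_nonneg_Reals: "c > 0 \<Longrightarrow> - complex_of_real c \<notin> \<real>\<^sub>\<ge>\<^sub>0"
  by (simp add: off_nonneg_Reals_iff)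

lemma diff_nonneg_neq_0: "z \<notin> \<real>\<^sub>\<ge>\<^sub>0 \<Longrightarrow> t \<ge> 0 \<Longrightarrow> z - complex_of_real t \<noteq> 0"
  by auto

lemma isCont_cauchy_kernel:
  "z \<notin> \<real>\<^sub>\<ge>\<^sub>0 \<Longrightarrow> t \<ge> 0 \<Longrightarrow> isCont (\<lambda>w. cauchy_kernel w t) z"
  unfolding cauchy_kernel_def by (intro continuous_intros) auto

lemma cauchy_kernel_locally_bounded:
  assumes "z \<notin> \<real>\<^sub>\<ge>\<^sub>0"
  obtains B where "B \<ge> 0" "\<forall>\<^sub>F w in nhds z. \<forall>t\<ge>0. cmod (cauchy_kernel w t) \<le> B"
proof -
  have "open (- \<real>\<^sub>\<ge>\<^sub>0 :: complex set)" by (simp add: open_Compl)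
  then obtain e where e: "e > 0" "ball z e \<subseteq> - \<real>\<^sub>\<ge>\<^sub>0"
    using assms unfolding open_contains_ball by auto
  have "cmod (cauchy_kernel w t) \<le> 2 / e" if "w \<in> ball z (e / 2)" "t \<ge> 0" for w t
  proof -
    have "complex_of_real t \<notin> ball z e" using e(2) that(2) by auto
    then have *: "e / 2 \<le> cmod (w - of_real t)"
      using that(1) norm_triangle_ineq[of "z - w" "w - of_real t"]
      by (simp add: dist_norm)
    have "1 / cmod (w - of_real t) \<le> 1 / (e / 2)"
      using * e(1) by (intro divide_left_mono mult_pos_pos) auto
    then show ?thesis
      unfolding cauchy_kernel_def norm_divide by simp
  qed
  moreover have "\<forall>\<^sub>F w in nhds z. w \<in> ball z (e / 2)"
    using e(1) by (intro eventually_nhds_in_open) auto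
  ultimately have "\<forall>\<^sub>F w in nhds z. \<forall>t\<ge>0. cmod (cauchy_kernel w t) \<le> 2 / e"
    by (auto elim: eventually_mono)
  with that[of "2 / e"] e(1) show thesis by simp
qed

lemma cauchy_kernel_bounded:
  assumes "z \<notin> \<real>\<^sub>\<ge>\<^sub>0"
  obtains B where "B \<ge> 0" "\<And>t. t \<ge> 0 \<Longrightarrow> cmod (cauchy_kernel z t) \<le> B"
proof -
  obtain B where "B \<ge> 0" "\<forall>\<^sub>F w in nhds z. \<forall>t\<ge>0. cmod (cauchy_kernel w t) \<le> B"
    using cauchy_kernel_locally_bounded[OF assms] by blast
  with that show thesis
    using eventually_nhds_x_imp_x by blast
qed

lemma cauchy_kernel_diff:
  assumes "z \<notin> \<real>\<^sub>\<ge>\<^sub>0" "w \<notin> \<real>\<^sub>\<ge>\<^sub>0" "t \<ge> 0"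
  shows "cauchy_kernel z t - cauchy_kernel w t = (w - z) * (cauchy_kernel z t * cauchy_kernel w t)"
  using diff_nonneg_neq_0[OF assms(1,3)] diff_nonneg_neq_0[OF assms(2,3)]
  unfolding cauchy_kernel_def by (simp add: divide_simps)

lemma integrable_cauchy_kernel_mult:
  assumes "z \<notin> \<real>\<^sub>\<ge>\<^sub>0" "w \<notin> \<real>\<^sub>\<ge>\<^sub>0"
  shows "integrable gamma_two (\<lambda>t. cauchy_kernel z t * cauchy_kernel w t)"
proof -
  obtain A where A: "A \<ge> 0" "\<And>t. t \<ge> 0 \<Longrightarrow> cmod (cauchy_kernel z t) \<le> A"
    using cauchy_kernel_bounded[OF assms(1)] by blast
  obtain B where B: "B \<ge> 0" "\<And>t. t \<ge> 0 \<Longrightarrow> cmod (cauchy_kernel w t) \<le> B"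
    using cauchy_kernel_bounded[OF assms(2)] by blast
  show ?thesis
    by (rule integrable_gamma_two[where B = "A * B"])
      (auto simp: norm_mult A B intro!: mult_mono)
qed

lemma integrable_cauchy_kernel_power:
  assumes "z \<notin> \<real>\<^sub>\<ge>\<^sub>0"
  shows "integrable gamma_two (\<lambda>t. cauchy_kernel z t ^ k)"
proof -
  obtain A where A: "A \<ge> 0" "\<And>t. t \<ge> 0 \<Longrightarrow> cmod (cauchy_kernel z t) \<le> A"
    using cauchy_kernel_bounded[OF assms(1)] by blast
  show ?thesis
    by (rule integrable_gamma_two[where B = "A ^ k"])
      (auto simp: norm_power A intro!: power_mono)
qed

definition cauchy_moment :: "nat \<Rightarrow> complex \<Rightarrow> complex" where
  "cauchy_moment k z = (LINT t|gamma_two. cauchy_kernel z t ^ k)"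

text \<open>
  The difference quotient of the \<open>k\<close>-th power factors as a finite sum of products of the kernels at
  the two points. That sum is bounded near \<open>z\<close> uniformly in \<open>t\<close>, so its integral is continuous
  there, and the limit can be taken under the integral sign.
\<close>

lemma has_field_derivative_cauchy_moment:
  assumes z: "z \<notin> \<real>\<^sub>\<ge>\<^sub>0"
  shows "(cauchy_moment k has_field_derivative (- of_nat k * cauchy_moment (Suc k) z)) (at z)"
proof -
  define q where "q w t = (\<Sum>i<k. cauchy_kernel w t * cauchy_kernel z t *
    (cauchy_kernel z t ^ (k - Suc i) * cauchy_kernel w t ^ i))" for w t
  obtain B where B: "B \<ge> 0" "\<forall>\<^sub>F w in nhds z. \<forall>t\<ge>0. cmod (cauchy_kernel w t) \<le> B"
    using cauchy_kernel_locally_bounded[OF z] by blast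
  have Bz: "cmod (cauchy_kernel z t) \<le> B" if "t \<ge> 0" for t
    using eventually_nhds_x_imp_x[OF B(2)] that by blast
  have bnd: "norm (q w t) \<le> (\<Sum>i<k. B * B * (B ^ (k - Suc i) * B ^ i))"
    if "cmod (cauchy_kernel w t) \<le> B" "t \<ge> 0" for w t
    unfolding q_def using that Bz[OF that(2)] B(1)
    by (intro sum_norm_le) (auto simp: norm_mult norm_power intro!: mult_mono power_mono)
  have cont: "isCont (\<lambda>w. LINT t|gamma_two. q w t) z"
  proof (rule isCont_integral_gamma_two)
    show "q w \<in> borel_measurable borel" for w
      unfolding q_def by measurable
    show "isCont (\<lambda>w. q w t) z" if "t \<ge> 0" for t
      unfolding q_def using isCont_cauchy_kernel[OF z that] by (intro continuous_intros)
    show "\<forall>\<^sub>F w in nhds z. \<forall>t\<ge>0. norm (q w t) \<le> (\<Sum>i<k. B * B * (B ^ (k - Suc i) * B ^ i))"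
      using B(2) by eventually_elim (use bnd in blast)
  qed
  have ev: "\<forall>\<^sub>F w in at z. - (LINT t|gamma_two. q w t)
      = (cauchy_moment k w - cauchy_moment k z) / (w - z)"
  proof -
    have "\<forall>\<^sub>F w in at z. w \<in> - \<real>\<^sub>\<ge>\<^sub>0 - {z}"
      using z by (intro eventually_at_in_open) (auto simp: open_Compl)
    then show ?thesis
    proof eventually_elim
      case (elim w)
      then have w: "w \<notin> \<real>\<^sub>\<ge>\<^sub>0" "w \<noteq> z" by auto
      have "cauchy_moment k w - cauchy_moment k z
          = (LINT t|gamma_two. cauchy_kernel w t ^ k - cauchy_kernel z t ^ k)"
        unfolding cauchy_moment_def
        by (intro Bochner_Integration.integral_diff[symmetric] integrable_cauchy_kernel_power w z)
      also have "\<dots> = (LINT t|gamma_two. (z - w) * q w t)"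
      proof (intro integral_cong_AE)
        show "AE t in gamma_two. cauchy_kernel w t ^ k - cauchy_kernel z t ^ k = (z - w) * q w t"
          using AE_gamma_two_nonneg
        proof eventually_elim
          case (elim t)
          show ?case
            unfolding q_def power_diff_sumr2 cauchy_kernel_diff[OF w(1) z elim]
            by (simp add: sum_distrib_left mult.assoc)
        qed
      qed (auto simp: q_def measurable_cong_sets[OF sets_gamma_two refl])
      also have "\<dots> = (z - w) * (LINT t|gamma_two. q w t)"
        by (rule integral_mult_right_zero)
      finally show ?case
        using w(2) by (simp add: field_simps)
    qed
  qed
  have "(LINT t|gamma_two. q z t) = of_nat k * cauchy_moment (Suc k) z"
  proof -
    have "q z t = of_nat k * cauchy_kernel z t ^ Suc k" for t
    proof -
      have "q z t = (\<Sum>i<k. cauchy_kernel z t ^ Suc k)"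
        unfolding q_def
      proof (intro sum.cong refl)
        fix i assume "i \<in> {..<k}"
        then have *: "Suc k = Suc (Suc ((k - Suc i) + i))" by auto
        show "cauchy_kernel z t * cauchy_kernel z t * (cauchy_kernel z t ^ (k - Suc i) * cauchy_kernel z t ^ i)
          = cauchy_kernel z t ^ Suc k"
          by (subst *) (simp only: power_Suc power_add mult.assoc)
      qed
      then show ?thesis by simp
    qed
    then show ?thesis by (simp add: cauchy_moment_def)
  qed
  then show ?thesis
    using Lim_transform_eventually[OF tendsto_minus[OF cont[unfolded isCont_def]] ev]
    unfolding has_field_derivative_iff by simp
qed


text \<open>
  Every integral whose limit at the edge is taken below has this form, with \<open>\<phi>\<close> the identity or the
  squared modulus and \<open>g\<close> a power of \<open>1 / (c + t)\<close>.
\<close>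

lemma isCont_integral_weighted_kernel:
  fixes \<phi> :: "complex \<Rightarrow> 'b::{banach, second_countable_topology}" and g :: "real \<Rightarrow> real"
  assumes z: "z \<notin> \<real>\<^sub>\<ge>\<^sub>0" and \<phi>: "continuous_on UNIV \<phi>"
    and g: "g \<in> borel_measurable borel" "\<And>t. t \<ge> 0 \<Longrightarrow> \<bar>g t\<bar> \<le> C"
  shows "isCont (\<lambda>w. LINT t|gamma_two. g t *\<^sub>R \<phi> (cauchy_kernel w t)) z"
proof -
  obtain B where B: "B \<ge> 0" "\<forall>\<^sub>F w in nhds z. \<forall>t\<ge>0. cmod (cauchy_kernel w t) \<le> B"
    using cauchy_kernel_locally_bounded[OF z] by blast
  have "compact (\<phi> ` cball 0 B)"
    by (intro compact_continuous_image continuous_on_subset[OF \<phi>]) auto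
  then obtain A where A: "\<And>k. cmod k \<le> B \<Longrightarrow> norm (\<phi> k) \<le> A"
    using compact_imp_bounded bounded_iff by (metis image_eqI mem_cball_0)
  have [measurable]: "\<phi> \<in> borel_measurable borel"
    using \<phi> by (rule borel_measurable_continuous_onI)
  note g(1)[measurable]
  show ?thesis
  proof (rule isCont_integral_gamma_two)
    show "isCont (\<lambda>w. g t *\<^sub>R \<phi> (cauchy_kernel w t)) z" if "t \<ge> 0" for t
      using \<phi> by (intro continuous_intros isCont_o2[OF isCont_cauchy_kernel[OF z that]])
        (auto simp: continuous_on_eq_continuous_at)
    show "\<forall>\<^sub>F w in nhds z. \<forall>t\<ge>0. norm (g t *\<^sub>R \<phi> (cauchy_kernel w t)) \<le> C * A"
      using B(2)
    proof eventually_elim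
      case (elim w)
      then show ?case
        using A g(2) by (auto intro!: mult_mono intro: order_trans[OF abs_ge_zero])
    qed
  qed measurable
qed

section \<open>The level sets of F\<close>

lemma free_gamma_H_eq:
  "free_gamma_H \<alpha> z = z + of_real \<alpha> + of_real \<alpha> * cauchy_moment 1 z"
proof -
  have "cauchy_moment 1 z
      = (LINT t:{0..}|lborel. complex_of_real (t * exp (- t)) / (z - complex_of_real t))"
    unfolding cauchy_moment_def
    by (subst integral_gamma_two) (auto simp: cauchy_kernel_def scaleR_conv_of_real)
  then show ?thesis by (simp add: free_gamma_H_def)
qed

lemma free_gamma_F_eq:
  "free_gamma_F z = (LINT t|gamma_two. (cmod (cauchy_kernel z t))\<^sup>2)"
  unfolding free_gamma_F_def
  by (subst integral_gamma_two) (auto simp: cauchy_kernel_def norm_divide power_divide)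

lemma integrable_norm_cauchy_kernel_squared:
  assumes "z \<notin> \<real>\<^sub>\<ge>\<^sub>0"
  shows "integrable gamma_two (\<lambda>t. (cmod (cauchy_kernel z t))\<^sup>2)"
  using integrable_norm[OF integrable_cauchy_kernel_power[OF assms, of 2]]
  by (simp add: norm_power)

lemma isCont_free_gamma_F:
  assumes "z \<notin> \<real>\<^sub>\<ge>\<^sub>0"
  shows "isCont free_gamma_F z"
proof -
  have "isCont (\<lambda>w. LINT t|gamma_two. 1 *\<^sub>R (cmod (cauchy_kernel w t))\<^sup>2) z"
    by (rule isCont_integral_weighted_kernel[OF assms, where C = 1]) (auto intro!: continuous_intros)
  then show ?thesis
    by (simp add: free_gamma_F_eq[abs_def])
qed

lemma isCont_free_gamma_F_compose:
  assumes "isCont g x" "g x \<notin> \<real>\<^sub>\<ge>\<^sub>0"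
  shows "isCont (\<lambda>x. free_gamma_F (g x)) x"
  using isCont_o2[OF assms(1) isCont_free_gamma_F[OF assms(2)]] .

lemma isCont_Complex_left: "isCont (\<lambda>x. Complex x y) x"
  and isCont_Complex_right: "isCont (\<lambda>y. Complex x y) y"
  by (auto simp: isCont_def intro!: tendsto_intros)

lemma free_gamma_F_strict_antimono:
  assumes z: "z \<notin> \<real>\<^sub>\<ge>\<^sub>0" and less: "\<And>t. t \<ge> 0 \<Longrightarrow> cmod (z - of_real t) < cmod (w - of_real t)"
  shows "free_gamma_F w < free_gamma_F z"
proof -
  have w: "w \<notin> \<real>\<^sub>\<ge>\<^sub>0"
  proof
    assume "w \<in> \<real>\<^sub>\<ge>\<^sub>0"
    then obtain s where "s \<ge> 0" "w = of_real s" by (auto elim: nonneg_Reals_cases)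
    with less[of s] show False by simp
  qed
  show ?thesis
    unfolding free_gamma_F_eq
  proof (intro integral_gamma_two_strict_mono integrable_norm_cauchy_kernel_squared w z)
    fix t :: real assume t: "t \<ge> 0"
    have "cmod (z - of_real t) > 0"
      using diff_nonneg_neq_0[OF z t] by simp
    then have "1 / cmod (w - of_real t) < 1 / cmod (z - of_real t)"
      using less[OF t] by (intro divide_strict_left_mono mult_pos_pos) auto
    then show "(cmod (cauchy_kernel w t))\<^sup>2 < (cmod (cauchy_kernel z t))\<^sup>2"
      unfolding cauchy_kernel_def norm_divide by (intro power_strict_mono) auto
  qed
qed

lemma free_gamma_F_le:
  assumes r: "r > 0" and dist: "\<And>t. t \<ge> 0 \<Longrightarrow> r \<le> cmod (z - of_real t)"
  shows "free_gamma_F z \<le> 1 / r\<^sup>2"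
proof -
  have z: "z \<notin> \<real>\<^sub>\<ge>\<^sub>0"
  proof
    assume "z \<in> \<real>\<^sub>\<ge>\<^sub>0"
    then obtain s where "s \<ge> 0" "z = of_real s" by (auto elim: nonneg_Reals_cases)
    with dist[of s] r show False by simp
  qed
  have "free_gamma_F z \<le> (LINT t|gamma_two. 1 / r\<^sup>2)"
    unfolding free_gamma_F_eq
  proof (intro integral_mono_AE integrable_norm_cauchy_kernel_squared z)
    show "AE t in gamma_two. (cmod (cauchy_kernel z t))\<^sup>2 \<le> 1 / r\<^sup>2"
      using AE_gamma_two_nonneg
    proof eventually_elim
      case (elim t)
      have "r\<^sup>2 \<le> (cmod (z - of_real t))\<^sup>2"
        using r dist[OF elim] by (intro power_mono) auto
      then show ?case
        unfolding cauchy_kernel_def norm_divide power_divide norm_one one_power2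
        using r by (intro divide_left_mono mult_pos_pos) (auto intro: less_le_trans)
    qed
  qed auto
  also have "\<dots> = 1 / r\<^sup>2"
    by (simp add: gamma_two.prob_space[unfolded space_gamma_two])
  finally show ?thesis .
qed

text \<open>
  Blow-up of \<open>F\<close> at the half-line. If \<open>z\<close> is at distance \<open>d\<close> from its point \<open>p\<close>, then
  \<open>\<bar>z - t\<bar> \<le> 2 (t - p)\<close> for \<open>t \<ge> p + d\<close>, and \<open>t \<ge> t - p\<close>. On \<open>[p + d, p + 1]\<close> the integrand
  is therefore at least a constant multiple of \<open>1 / (t - p)\<close>, whose integral diverges logarithmically
  as \<open>d\<close> tends to \<open>0\<close>. The origin is the delicate point, because there the weight \<open>t exp (- t)\<close>
  vanishes.
\<close>

lemma free_gamma_F_ge: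
  fixes z :: complex and p :: real
  defines "d \<equiv> cmod (z - of_real p)"
  assumes z: "z \<notin> \<real>\<^sub>\<ge>\<^sub>0" and p: "p \<ge> 0" and d: "d < 1"
  shows "free_gamma_F z \<ge> exp (- (p + 1)) / 4 * ln (1 / d)"
proof -
  have d0: "d > 0" using diff_nonneg_neq_0[OF z p] by (simp add: d_def)
  have cancel: "s * a * (1 / (2 * s)\<^sup>2) = a / 4 * (1 / s)" if "s \<noteq> 0" for s a :: real
    using that by (simp add: power2_eq_square divide_simps)
  define f where "f t = exp (- (p + 1)) / 4 * (1 / (t - p))" for t
  define F where "F t = exp (- (p + 1)) / 4 * ln (t - p)" for t
  have ftc: "has_bochner_integral lborel (\<lambda>t. f t * indicator {p + d .. p + 1} t) (F (p + 1) - F (p + d))"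
  proof (rule has_bochner_integral_FTC_Icc_real)
    show "p + d \<le> p + 1" using d by simp
    fix t assume "p + d \<le> t"
    then have t: "t - p > 0" using d0 by simp
    show "(F has_real_derivative f t) (at t)"
      unfolding F_def f_def using t
      by (auto intro!: derivative_eq_intros simp del: times_divide_eq_left times_divide_eq_right)
    show "isCont f t"
      unfolding f_def using t by (intro continuous_intros) auto
  qed
  have int: "integrable lborel (\<lambda>t. erlang_density 1 1 t * (cmod (cauchy_kernel z t))\<^sup>2)"
    using integrable_norm_cauchy_kernel_squared[OF z] unfolding gamma_two_def
    by (subst (asm) integrable_real_density) (auto simp: erlang_density_nonneg)
  have "exp (- (p + 1)) / 4 * ln (1 / d) = F (p + 1) - F (p + d)"
    unfolding F_def using d0 by (simp add: ln_div)
  also have "\<dots> = (LINT t|lborel. f t * indicator {p + d .. p + 1} t)"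
    using ftc by (simp add: has_bochner_integral_integral_eq)
  also have "\<dots> \<le> (LINT t|lborel. erlang_density 1 1 t * (cmod (cauchy_kernel z t))\<^sup>2)"
  proof (rule integral_mono[OF _ int])
    show "integrable lborel (\<lambda>t. f t * indicator {p + d .. p + 1} t)"
      using ftc by (rule integrable.intros)
    fix t :: real
    show "f t * indicator {p + d .. p + 1} t \<le> erlang_density 1 1 t * (cmod (cauchy_kernel z t))\<^sup>2"
    proof (cases "t \<in> {p + d .. p + 1}")
      case True
      then have t: "p + d \<le> t" "t \<le> p + 1" by auto
      have t0: "t \<ge> 0" using t p d0 by linarith
      have "cmod (z - of_real t) = cmod ((z - of_real p) + of_real (p - t))" by simp
      also have "\<dots> \<le> d + \<bar>p - t\<bar>"
        unfolding d_def norm_of_real[where 'a = complex, symmetric] by (rule norm_triangle_ineq)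
      finally have "cmod (z - of_real t) \<le> d + (t - p)" using t d0 by simp
      then have "cmod (z - of_real t) \<le> 2 * (t - p)" using t by simp
      then have "(cmod (z - of_real t))\<^sup>2 \<le> (2 * (t - p))\<^sup>2" by (intro power_mono) auto
      moreover have "cmod (z - of_real t) > 0" using diff_nonneg_neq_0[OF z t0] by simp
      ultimately have k: "1 / (2 * (t - p))\<^sup>2 \<le> (cmod (cauchy_kernel z t))\<^sup>2"
        unfolding cauchy_kernel_def norm_divide power_divide norm_one one_power2
        using t d0 by (intro divide_left_mono mult_pos_pos) auto
      have "(t - p) * exp (- (p + 1)) \<le> t * exp (- t)"
        using t p t0 by (intro mult_mono) auto
      then have "((t - p) * exp (- (p + 1))) * (1 / (2 * (t - p))\<^sup>2)
          \<le> (t * exp (- t)) * (cmod (cauchy_kernel z t))\<^sup>2"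
        by (rule mult_mono[OF _ k]) (use t0 in auto)
      also have "((t - p) * exp (- (p + 1))) * (1 / (2 * (t - p))\<^sup>2) = f t"
        unfolding f_def using t d0 by (intro cancel) auto
      finally show ?thesis
        unfolding erlang_density_1_1 using True t0 by simp
    next
      case False
      then show ?thesis by (simp add: erlang_density_nonneg)
    qed
  qed
  also have "\<dots> = free_gamma_F z"
    unfolding free_gamma_F_eq gamma_two_def
    by (subst integral_real_density) (auto simp: erlang_density_nonneg)
  finally show ?thesis .
qed

lemma ex_free_gamma_F_large:
  assumes "\<alpha> > 0" "p \<ge> 0"
  shows "\<exists>d>0. \<forall>z. z \<notin> \<real>\<^sub>\<ge>\<^sub>0 \<longrightarrow> cmod (z - of_real p) = d \<longrightarrow> free_gamma_F z \<ge> 1 / \<alpha>"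
proof -
  \<comment> \<open>The distance at which the logarithmic lower bound for \<open>F\<close> equals \<open>1 / \<alpha>\<close>.\<close>
  define d where "d = exp (- (4 * exp (p + 1) / \<alpha>))"
  have "0 < 4 * exp (p + 1) / \<alpha>" using assms by simp
  then have d: "d > 0" "d < 1" unfolding d_def by auto
  have "1 / d = exp (4 * exp (p + 1) / \<alpha>)"
    by (simp add: d_def exp_minus inverse_eq_divide)
  then have "exp (- (p + 1)) / 4 * ln (1 / d) = (exp (p + 1) * exp (- (p + 1))) * (1 / \<alpha>)"
    by (simp only: ln_exp) simp
  then have "1 / \<alpha> = exp (- (p + 1)) / 4 * ln (1 / d)"
    by (simp only: exp_minus_inverse mult_1)
  then have "free_gamma_F z \<ge> 1 / \<alpha>" if "z \<notin> \<real>\<^sub>\<ge>\<^sub>0" "cmod (z - of_real p) = d" for z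
    using free_gamma_F_ge[OF that(1) assms(2)] that(2) d by simp
  with d(1) show ?thesis by blast
qed

lemma Complex_eq_of_real: "Complex x 0 = of_real x"
  by (simp add: complex_eq_iff)

lemma free_gamma_F_neg_real_strict_antimono:
  assumes "0 < c" "c < c'"
  shows "free_gamma_F (- of_real c') < free_gamma_F (- of_real c)"
proof (rule free_gamma_F_strict_antimono[OF neg_real_off_nonneg_Reals[OF assms(1)]])
  fix t :: real assume "t \<ge> 0"
  then show "cmod (- of_real c - of_real t) < cmod (- of_real c' - of_real t)"
    using assms unfolding of_real_minus[symmetric] of_real_diff[symmetric] norm_of_real by simp
qed

lemma free_gamma_F_vertical_strict_antimono:
  assumes "Complex x y \<notin> \<real>\<^sub>\<ge>\<^sub>0" "0 \<le> y" "y < y'"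
  shows "free_gamma_F (Complex x y') < free_gamma_F (Complex x y)"
proof (rule free_gamma_F_strict_antimono[OF assms(1)])
  fix t :: real
  show "cmod (Complex x y - of_real t) < cmod (Complex x y' - of_real t)"
    using assms(2,3) unfolding cmod_def
    by (auto intro!: real_sqrt_less_mono power_strict_mono)
qed

text \<open>
  On the negative axis \<open>F\<close> increases strictly from \<open>0\<close> at \<open>- \<infinity>\<close> to \<open>\<infinity>\<close> at the origin.
\<close>

lemma ex1_free_gamma_c:
  assumes "\<alpha> > 0"
  shows "\<exists>!c. c > 0 \<and> free_gamma_F (- complex_of_real c) = 1 / \<alpha>"
proof (rule ex_ex1I)
  obtain a where a: "a > 0" "free_gamma_F (- complex_of_real a) \<ge> 1 / \<alpha>"
  proof -
    obtain d where "d > 0" "\<And>z. z \<notin> \<real>\<^sub>\<ge>\<^sub>0 \<Longrightarrow> cmod (z - of_real 0) = d \<Longrightarrow> free_gamma_F z \<ge> 1 / \<alpha>"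
      using ex_free_gamma_F_large[OF assms order_refl] by blast
    with that[of d] neg_real_off_nonneg_Reals[of d] show thesis by simp
  qed
  \<comment> \<open>\<open>F z\<close> is at most the inverse square of the distance from \<open>z\<close> to the half-line, so distance
    \<open>sqrt \<alpha>\<close> is enough.\<close>
  define b where "b = max a (sqrt \<alpha>)"
  have b: "b \<ge> a" "b > 0" using a by (auto simp: b_def)
  have "free_gamma_F (- complex_of_real b) \<le> 1 / b\<^sup>2"
  proof (rule free_gamma_F_le[OF b(2)])
    fix t :: real assume "t \<ge> 0"
    then show "b \<le> cmod (- of_real b - of_real t)"
      using b(2) unfolding of_real_minus[symmetric] of_real_diff[symmetric] norm_of_real by simp
  qed
  also have "\<dots> \<le> 1 / \<alpha>"
  proof -
    have "(sqrt \<alpha>)\<^sup>2 \<le> b\<^sup>2" using assms by (intro power_mono) (auto simp: b_def)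
    then show ?thesis using assms b(2) by (intro divide_left_mono) auto
  qed
  finally have Fb: "free_gamma_F (- complex_of_real b) \<le> 1 / \<alpha>" .
  have "\<exists>x\<ge>a. x \<le> b \<and> free_gamma_F (- complex_of_real x) = 1 / \<alpha>"
  proof (rule IVT2[OF Fb a(2) b(1)], intro allI impI)
    fix x assume "a \<le> x \<and> x \<le> b"
    then have x: "- complex_of_real x \<notin> \<real>\<^sub>\<ge>\<^sub>0" using a(1) by (intro neg_real_off_nonneg_Reals) auto
    show "isCont (\<lambda>x. free_gamma_F (- complex_of_real x)) x"
      by (intro isCont_free_gamma_F_compose x continuous_intros)
  qed
  then obtain x where "a \<le> x" "free_gamma_F (- complex_of_real x) = 1 / \<alpha>" by blast
  with a(1) show "\<exists>c>0. free_gamma_F (- complex_of_real c) = 1 / \<alpha>"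
    by (intro exI[of _ x]) auto
next
  fix c c' :: real
  assume "c > 0 \<and> free_gamma_F (- of_real c) = 1 / \<alpha>" "c' > 0 \<and> free_gamma_F (- of_real c') = 1 / \<alpha>"
  then show "c = c'"
    using free_gamma_F_neg_real_strict_antimono[of c c'] free_gamma_F_neg_real_strict_antimono[of c' c]
    by (cases c c' rule: linorder_cases) auto
qed

lemma isCont_free_gamma_F_vertical:
  assumes "Complex x y \<notin> \<real>\<^sub>\<ge>\<^sub>0"
  shows "isCont (\<lambda>y. free_gamma_F (Complex x y)) y"
  by (intro isCont_free_gamma_F_compose isCont_Complex_right assms)

lemma isCont_free_gamma_F_horizontal:
  assumes "Complex x y \<notin> \<real>\<^sub>\<ge>\<^sub>0"
  shows "isCont (\<lambda>x. free_gamma_F (Complex x y)) x"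
  by (intro isCont_free_gamma_F_compose isCont_Complex_left assms)


section \<open>Divided differences and derivatives of H\<close>

lemma free_gamma_H_diff:
  assumes z: "z \<notin> \<real>\<^sub>\<ge>\<^sub>0" and w: "w \<notin> \<real>\<^sub>\<ge>\<^sub>0"
  shows "free_gamma_H \<alpha> z - free_gamma_H \<alpha> w
    = (z - w) * (1 - of_real \<alpha> * (LINT t|gamma_two. cauchy_kernel z t * cauchy_kernel w t))"
proof -
  have "cauchy_moment 1 z - cauchy_moment 1 w
      = (LINT t|gamma_two. cauchy_kernel z t - cauchy_kernel w t)"
    unfolding cauchy_moment_def power_one_right
    using integrable_cauchy_kernel_power[OF z, of 1] integrable_cauchy_kernel_power[OF w, of 1]
    by (intro Bochner_Integration.integral_diff[symmetric]) auto
  also have "\<dots> = (LINT t|gamma_two. (w - z) * (cauchy_kernel z t * cauchy_kernel w t))"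
  proof (intro integral_cong_AE)
    show "AE t in gamma_two. cauchy_kernel z t - cauchy_kernel w t
        = (w - z) * (cauchy_kernel z t * cauchy_kernel w t)"
      using AE_gamma_two_nonneg by eventually_elim (rule cauchy_kernel_diff[OF z w])
  qed (auto simp: measurable_cong_sets[OF sets_gamma_two refl])
  also have "\<dots> = (w - z) * (LINT t|gamma_two. cauchy_kernel z t * cauchy_kernel w t)"
    by (rule integral_mult_right_zero)
  finally have "cauchy_moment 1 z - cauchy_moment 1 w
      = (w - z) * (LINT t|gamma_two. cauchy_kernel z t * cauchy_kernel w t)" .
  then have "cauchy_moment 1 z = cauchy_moment 1 w
      + (w - z) * (LINT t|gamma_two. cauchy_kernel z t * cauchy_kernel w t)"
    by (simp only: diff_eq_eq add.commute)
  then show ?thesis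
    unfolding free_gamma_H_eq by (simp only:) (simp add: ring_distribs)
qed

lemma Re_mult_less_mean_norm_squared:
  assumes "a \<noteq> cnj b"
  shows "Re (a * b) < ((cmod a)\<^sup>2 + (cmod b)\<^sup>2) / 2"
proof -
  have "0 < (cmod (a - cnj b))\<^sup>2" using assms by simp
  also have "\<dots> = (cmod a)\<^sup>2 + (cmod b)\<^sup>2 - 2 * Re (a * b)"
    unfolding cmod_power2 by (simp add: power2_eq_square algebra_simps)
  finally show ?thesis by simp
qed

text \<open>
  On the set where \<open>\<alpha> F \<le> 1\<close> this makes the real part of \<open>(H z - H w) / (z - w)\<close> positive, so that
  \<open>H\<close> is injective on the part of that set in the closed upper half-plane. The excluded case
  \<open>z = cnj w\<close> is the one in which the mean of the two squares is attained for every \<open>t\<close>.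
\<close>

lemma Re_integral_kernel_product_less:
  assumes z: "z \<notin> \<real>\<^sub>\<ge>\<^sub>0" and w: "w \<notin> \<real>\<^sub>\<ge>\<^sub>0" and ne: "z \<noteq> cnj w"
  shows "Re (LINT t|gamma_two. cauchy_kernel z t * cauchy_kernel w t)
    < (free_gamma_F z + free_gamma_F w) / 2"
proof -
  note int = integrable_cauchy_kernel_mult[OF z w]
    integrable_norm_cauchy_kernel_squared[OF z] integrable_norm_cauchy_kernel_squared[OF w]
  have "Re (LINT t|gamma_two. cauchy_kernel z t * cauchy_kernel w t)
      = (LINT t|gamma_two. Re (cauchy_kernel z t * cauchy_kernel w t))"
    by (rule integral_Re[OF int(1), symmetric])
  also have "\<dots> < (LINT t|gamma_two. ((cmod (cauchy_kernel z t))\<^sup>2 + (cmod (cauchy_kernel w t))\<^sup>2) / 2)"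
  proof (rule integral_gamma_two_strict_mono)
    fix t :: real assume "t \<ge> 0"
    have "cauchy_kernel z t \<noteq> cnj (cauchy_kernel w t)"
      using ne unfolding cauchy_kernel_def by (auto simp: complex_cnj_cancel_iff)
    then show "Re (cauchy_kernel z t * cauchy_kernel w t)
      < ((cmod (cauchy_kernel z t))\<^sup>2 + (cmod (cauchy_kernel w t))\<^sup>2) / 2"
      by (rule Re_mult_less_mean_norm_squared)
  qed (use int in \<open>auto simp del: times_complex.sel\<close>)
  also have "\<dots> = (free_gamma_F z + free_gamma_F w) / 2"
    unfolding free_gamma_F_eq using int(2,3) by simp
  finally show ?thesis .
qed

text \<open>
  Hence, off the real axis, \<open>H\<close> is real exactly on the level set \<open>\<alpha> F = 1\<close>.
\<close>

lemma Im_free_gamma_H: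
  assumes z: "z \<notin> \<real>\<^sub>\<ge>\<^sub>0"
  shows "Im (free_gamma_H \<alpha> z) = Im z * (1 - \<alpha> * free_gamma_F z)"
proof -
  have "Im (cauchy_moment 1 z) = (LINT t|gamma_two. Im (cauchy_kernel z t))"
    using integrable_cauchy_kernel_power[OF z, of 1] unfolding cauchy_moment_def by simp
  also have "\<dots> = (LINT t|gamma_two. (- Im z) * (cmod (cauchy_kernel z t))\<^sup>2)"
    by (intro Bochner_Integration.integral_cong refl)
      (simp add: cauchy_kernel_def Im_divide cmod_power2 norm_divide power_divide)
  also have "\<dots> = (- Im z) * free_gamma_F z"
    unfolding free_gamma_F_eq by (rule integral_mult_right_zero)
  finally show ?thesis
    unfolding free_gamma_H_eq by (simp add: algebra_simps)
qed

lemma has_field_derivative_free_gamma_H: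
  assumes "z \<notin> \<real>\<^sub>\<ge>\<^sub>0"
  shows "(free_gamma_H \<alpha> has_field_derivative (1 - of_real \<alpha> * cauchy_moment 2 z)) (at z)"
  unfolding free_gamma_H_eq[abs_def]
  by (auto intro!: derivative_eq_intros has_field_derivative_cauchy_moment[OF assms] simp: numeral_2_eq_2)

lemma isCont_free_gamma_H:
  assumes "z \<notin> \<real>\<^sub>\<ge>\<^sub>0"
  shows "isCont (free_gamma_H \<alpha>) z"
  using has_field_derivative_free_gamma_H[OF assms] by (rule DERIV_isCont)

lemma deriv_eq_on_slit_plane:
  fixes f g :: "complex \<Rightarrow> complex"
  assumes "z \<notin> \<real>\<^sub>\<ge>\<^sub>0" "\<And>w. w \<notin> \<real>\<^sub>\<ge>\<^sub>0 \<Longrightarrow> f w = g w" "(g has_field_derivative D) (at z)"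
  shows "deriv f z = D"
proof (rule DERIV_imp_deriv)
  show "(f has_field_derivative D) (at z)"
    using assms(3)
    by (rule has_field_derivative_transform_within_open[where S = "- \<real>\<^sub>\<ge>\<^sub>0"])
      (use assms in \<open>auto simp: open_Compl\<close>)
qed

lemma higher_derivs_free_gamma_H:
  assumes "z \<notin> \<real>\<^sub>\<ge>\<^sub>0"
  shows "(deriv ^^ 2) (free_gamma_H \<alpha>) z = 2 * of_real \<alpha> * cauchy_moment 3 z"
    and "(deriv ^^ 3) (free_gamma_H \<alpha>) z = - 6 * of_real \<alpha> * cauchy_moment 4 z"
proof -
  have d1: "deriv (free_gamma_H \<alpha>) w = 1 - of_real \<alpha> * cauchy_moment 2 w" if "w \<notin> \<real>\<^sub>\<ge>\<^sub>0" for w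
    using has_field_derivative_free_gamma_H[OF that] by (rule DERIV_imp_deriv)
  have d2: "(deriv ^^ 2) (free_gamma_H \<alpha>) w = 2 * of_real \<alpha> * cauchy_moment 3 w" if "w \<notin> \<real>\<^sub>\<ge>\<^sub>0" for w
  proof -
    have "((\<lambda>w. 1 - of_real \<alpha> * cauchy_moment 2 w) has_field_derivative
        2 * of_real \<alpha> * cauchy_moment 3 w) (at w)"
      by (auto intro!: derivative_eq_intros has_field_derivative_cauchy_moment[OF that]
          simp: eval_nat_numeral)
    from deriv_eq_on_slit_plane[OF that d1 this] show ?thesis
      by (simp add: numeral_2_eq_2)
  qed
  show "(deriv ^^ 2) (free_gamma_H \<alpha>) z = 2 * of_real \<alpha> * cauchy_moment 3 z"
    by (rule d2[OF assms])
  have "((\<lambda>w. 2 * of_real \<alpha> * cauchy_moment 3 w) has_field_derivative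
      2 * of_real \<alpha> * (- of_nat 3 * cauchy_moment (Suc 3) z)) (at z)"
    by (intro DERIV_cmult has_field_derivative_cauchy_moment[OF assms])
  from deriv_eq_on_slit_plane[OF assms d2 this]
  show "(deriv ^^ 3) (free_gamma_H \<alpha>) z = - 6 * of_real \<alpha> * cauchy_moment 4 z"
    by (simp add: eval_nat_numeral)
qed

section \<open>Behaviour at a point of the negative axis\<close>

definition inverse_moment :: "nat \<Rightarrow> real \<Rightarrow> real" where
  "inverse_moment k c = (LINT t|gamma_two. 1 / (c + t) ^ k)"

lemma cauchy_kernel_neg_real: "cauchy_kernel (- of_real c) t = - of_real (1 / (c + t))"
  unfolding cauchy_kernel_def by (simp flip: of_real_add of_real_minus add: minus_divide_right)

lemma integrable_inverse_moment:
  assumes "c > 0"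
  shows "integrable gamma_two (\<lambda>t. 1 / (c + t) ^ k)"
proof (rule integrable_gamma_two)
  fix t :: real assume "t \<ge> 0"
  then show "norm (1 / (c + t) ^ k) \<le> 1 / c ^ k"
    using assms by (auto intro!: divide_left_mono power_mono mult_pos_pos)
qed measurable

lemma inverse_moment_pos:
  assumes "c > 0"
  shows "inverse_moment k c > 0"
proof -
  have "(LINT t|gamma_two. 0 :: real) < inverse_moment k c"
    unfolding inverse_moment_def
    by (rule integral_gamma_two_strict_mono) (use assms integrable_inverse_moment in auto)
  then show ?thesis by simp
qed

lemma cauchy_moment_neg_real:
  "cauchy_moment k (- of_real c) = (- 1) ^ k * of_real (inverse_moment k c)"
proof -
  have "cauchy_kernel (- of_real c) t ^ k = (- 1) ^ k * of_real (1 / (c + t) ^ k)" for t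
    unfolding cauchy_kernel_neg_real power_minus[of "of_real _"] by (simp add: power_divide)
  then show ?thesis
    unfolding cauchy_moment_def inverse_moment_def
    by (simp only: integral_mult_right_zero integral_complex_of_real)
qed

lemma free_gamma_F_neg_real: "free_gamma_F (- of_real c) = inverse_moment 2 c"
  unfolding free_gamma_F_eq inverse_moment_def cauchy_kernel_neg_real norm_minus_cancel norm_of_real
  by (simp add: power_divide)

text \<open>
  The integrand \<open>t exp (- t) (1 - 1 / (c + t) - (c + c\<^sup>2) / (c + t)\<^sup>2 - 2 c\<^sup>2 / (c + t)\<^sup>3)\<close> has the
  antiderivative \<open>- exp (- t) t\<^sup>2 (t + 2 c) / (c + t)\<^sup>2\<close>, which vanishes at \<open>0\<close> and at infinity.
\<close>

lemma inverse_moment_relation: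
  assumes c: "c > 0"
  shows "1 - inverse_moment 1 c - (c + c\<^sup>2) * inverse_moment 2 c - 2 * c\<^sup>2 * inverse_moment 3 c = 0"
proof -
  define f where "f t = 1 - 1 / (c + t) ^ 1 - (c + c\<^sup>2) * (1 / (c + t) ^ 2) - 2 * c\<^sup>2 * (1 / (c + t) ^ 3)" for t
  \<comment> \<open>\<open>G\<close> is the antiderivative of \<open>t exp (- t) f t\<close>; its derivative is \<open>exp (- t) (R - R')\<close>.\<close>
  define R where "R t = t\<^sup>2 * (t + 2 * c) / (c + t)\<^sup>2" for t
  define G where "G t = - exp (- t) * R t" for t
  note int = integrable_inverse_moment[OF c]
  have f: "integrable gamma_two f"
    unfolding f_def
    by (intro Bochner_Integration.integrable_diff integrable_mult_right int) auto
  have [measurable]: "f \<in> borel_measurable borel"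
    unfolding f_def by measurable
  have ind: "indicat_real {0..} t * (t * exp (- t) * f t) = indicat_real {0<..} t * (t * exp (- t) * f t)" for t
    by (auto simp: indicator_def)
  have "(LINT t|gamma_two. f t) = (LBINT t:{0<..}. t * exp (- t) * f t)"
    by (subst integral_gamma_two) (simp_all add: set_lebesgue_integral_def real_scaleR_def ind)
  also have "\<dots> = (LBINT t=ereal 0..\<infinity>. t * exp (- t) * f t)"
    by (simp only: interval_integral_to_infinity_eq)
  also have "\<dots> = 0 - 0"
  proof (rule interval_integral_FTC_integrable)
    fix t :: real assume "ereal 0 < ereal t"
    then have t: "t > 0" by simp
    have ne: "c + t \<noteq> 0" using c t by simp
    define r where "r = ((2 * t * (t + 2 * c) + t\<^sup>2) * (c + t) - 2 * (t\<^sup>2 * (t + 2 * c))) / (c + t) ^ 3"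
    have R: "(R has_real_derivative r) (at t)"
      unfolding R_def r_def using ne
      by (auto intro!: derivative_eq_intros simp: divide_simps) (simp add: algebra_simps eval_nat_numeral)
    have "(G has_real_derivative exp (- t) * (R t - r)) (at t)"
      unfolding G_def by (auto intro!: derivative_eq_intros R simp: algebra_simps)
    moreover have "R t - r = t * f t"
      unfolding R_def r_def f_def using ne
      by (simp add: divide_simps) (simp add: algebra_simps eval_nat_numeral)
    ultimately have "(G has_real_derivative t * exp (- t) * f t) (at t)"
      by (simp add: mult_ac)
    then show "(G has_vector_derivative t * exp (- t) * f t) (at t)"
      by (simp add: has_real_derivative_iff_has_vector_derivative)
    show "isCont (\<lambda>t. t * exp (- t) * f t) t"
      unfolding f_def using ne by (intro continuous_intros) auto
  next
    have "integrable lborel (\<lambda>t. erlang_density 1 1 t * f t)"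
      using f unfolding gamma_two_def
      by (subst (asm) integrable_real_density) (auto simp: erlang_density_nonneg)
    then show "set_integrable lborel (einterval (ereal 0) \<infinity>) (\<lambda>t. t * exp (- t) * f t)"
      unfolding set_integrable_def erlang_density_1_1
      by (simp add: ind[unfolded mult.assoc] mult.assoc)
  next
    have "(G \<longlongrightarrow> G 0) (at 0)"
      using c unfolding G_def R_def by (intro tendsto_intros) auto
    then have "(G \<longlongrightarrow> 0) (at_right 0)"
      by (auto simp: G_def R_def intro: tendsto_within_subset)
    then show "((G \<circ> real_of_ereal) \<longlongrightarrow> 0) (at_right (ereal 0))"
      by (simp add: ereal_tendsto_simps)
  next
    have "(G \<longlongrightarrow> 0) at_top"
      unfolding G_def R_def using c by real_asymp
    then show "((G \<circ> real_of_ereal) \<longlongrightarrow> 0) (at_left \<infinity>)"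
      by (simp add: ereal_tendsto_simps)
  qed auto
  finally have "(LINT t|gamma_two. f t) = 0" by simp
  moreover have "(LINT t|gamma_two. f t)
      = 1 - inverse_moment 1 c - (c + c\<^sup>2) * inverse_moment 2 c - 2 * c\<^sup>2 * inverse_moment 3 c"
    unfolding f_def inverse_moment_def
    by (simp only: Bochner_Integration.integral_diff Bochner_Integration.integrable_diff
        integrable_mult_right integral_mult_right_zero gamma_two.integrable_const int)
      (simp add: gamma_two.prob_space[unfolded space_gamma_two])
  ultimately show ?thesis by simp
qed


text \<open>
  The pointwise identity behind this is
  \<open>(c + t)\<^sup>2 - \<bar>z - t\<bar>\<^sup>2 = 2 Re (z + c) (c + t) - \<bar>z + c\<bar>\<^sup>2\<close>, divided by
  \<open>(c + t)\<^sup>2 \<bar>z - t\<bar>\<^sup>2\<close>.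
\<close>

lemma free_gamma_F_expansion:
  assumes z: "z \<notin> \<real>\<^sub>\<ge>\<^sub>0" and c: "c > 0"
  shows "free_gamma_F z - free_gamma_F (- of_real c)
    = 2 * Re (z + of_real c) * (LINT t|gamma_two. (1 / (c + t) ^ 1) *\<^sub>R (cmod (cauchy_kernel z t))\<^sup>2)
      - (cmod (z + of_real c))\<^sup>2 * (LINT t|gamma_two. (1 / (c + t) ^ 2) *\<^sub>R (cmod (cauchy_kernel z t))\<^sup>2)"
proof -
  note int = integrable_norm_cauchy_kernel_squared[OF z]
  obtain B where B: "B \<ge> 0" "\<And>t. t \<ge> 0 \<Longrightarrow> cmod (cauchy_kernel z t) \<le> B"
    using cauchy_kernel_bounded[OF z] by blast
  have int_k: "integrable gamma_two (\<lambda>t. (1 / (c + t) ^ k) *\<^sub>R (cmod (cauchy_kernel z t))\<^sup>2)" for k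
  proof (rule integrable_gamma_two)
    fix t :: real assume t: "t \<ge> 0"
    then have "1 / (c + t) ^ k \<le> 1 / c ^ k"
      using c by (auto intro!: divide_left_mono power_mono mult_pos_pos)
    then have "1 / (c + t) ^ k * (cmod (cauchy_kernel z t))\<^sup>2 \<le> 1 / c ^ k * B\<^sup>2"
      using c t B by (intro mult_mono power_mono) auto
    then show "norm ((1 / (c + t) ^ k) *\<^sub>R (cmod (cauchy_kernel z t))\<^sup>2) \<le> 1 / c ^ k * B\<^sup>2"
      using c t by simp
  qed measurable
  have "free_gamma_F z - free_gamma_F (- of_real c)
      = (LINT t|gamma_two. (cmod (cauchy_kernel z t))\<^sup>2 - 1 / (c + t) ^ 2)"
    unfolding free_gamma_F_neg_real inverse_moment_def unfolding free_gamma_F_eq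
    by (intro Bochner_Integration.integral_diff[symmetric] int integrable_inverse_moment c)
  also have "\<dots> = (LINT t|gamma_two.
      2 * Re (z + of_real c) * ((1 / (c + t) ^ 1) *\<^sub>R (cmod (cauchy_kernel z t))\<^sup>2)
      - (cmod (z + of_real c))\<^sup>2 * ((1 / (c + t) ^ 2) *\<^sub>R (cmod (cauchy_kernel z t))\<^sup>2))"
  proof (intro integral_cong_AE)
    show "AE t in gamma_two. (cmod (cauchy_kernel z t))\<^sup>2 - 1 / (c + t) ^ 2
      = 2 * Re (z + of_real c) * ((1 / (c + t) ^ 1) *\<^sub>R (cmod (cauchy_kernel z t))\<^sup>2)
      - (cmod (z + of_real c))\<^sup>2 * ((1 / (c + t) ^ 2) *\<^sub>R (cmod (cauchy_kernel z t))\<^sup>2)"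
      using AE_gamma_two_nonneg
    proof eventually_elim
      case (elim t)
      define N where "N = (cmod (z - of_real t))\<^sup>2"
      have N: "N \<noteq> 0" using diff_nonneg_neq_0[OF z elim] by (simp add: N_def)
      have k: "(cmod (cauchy_kernel z t))\<^sup>2 = 1 / N"
        by (simp add: cauchy_kernel_def norm_divide power_divide N_def)
      have ct: "c + t \<noteq> 0" using c elim by simp
      have "(c + t)\<^sup>2 - N = 2 * Re (z + of_real c) * (c + t) - (cmod (z + of_real c))\<^sup>2"
        unfolding N_def cmod_power2 by (simp add: power2_eq_square algebra_simps)
      moreover have "1 / N - 1 / (c + t) ^ 2 = ((c + t)\<^sup>2 - N) / (N * (c + t)\<^sup>2)"
        using N ct by (simp add: divide_simps)
      ultimately show ?case
        unfolding k using N ct by (simp add: divide_simps) (simp add: power2_eq_square algebra_simps)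
    qed
  qed (auto simp: measurable_cong_sets[OF sets_gamma_two refl])
  also have "\<dots> = 2 * Re (z + of_real c) * (LINT t|gamma_two. (1 / (c + t) ^ 1) *\<^sub>R (cmod (cauchy_kernel z t))\<^sup>2)
      - (cmod (z + of_real c))\<^sup>2 * (LINT t|gamma_two. (1 / (c + t) ^ 2) *\<^sub>R (cmod (cauchy_kernel z t))\<^sup>2)"
    using int_k[of 1] int_k[of 2]
    by (subst Bochner_Integration.integral_diff)
      (simp_all only: integrable_mult_right integral_mult_right_zero)
  finally show ?thesis .
qed

text \<open>
  The hypothesis \<open>crit\<close> says that \<open>- c\<close> is a critical point of \<open>H\<close>. It removes the linear term.
\<close>

lemma free_gamma_H_expansion:
  assumes z: "z \<notin> \<real>\<^sub>\<ge>\<^sub>0" and c: "c > 0" and crit: "\<alpha> * free_gamma_F (- of_real c) = 1"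
  shows "free_gamma_H \<alpha> z - free_gamma_H \<alpha> (- of_real c)
    = of_real \<alpha> * (z + of_real c)\<^sup>2 * (LINT t|gamma_two. (1 / (c + t) ^ 2) *\<^sub>R cauchy_kernel z t)"
proof -
  have c': "- complex_of_real c \<notin> \<real>\<^sub>\<ge>\<^sub>0" by (rule neg_real_off_nonneg_Reals[OF c])
  note int = integrable_cauchy_kernel_mult[OF z c'] integrable_cauchy_kernel_power[OF c', of 2]
  have "1 - of_real \<alpha> * (LINT t|gamma_two. cauchy_kernel z t * cauchy_kernel (- of_real c) t)
    = of_real \<alpha> * (cauchy_moment 2 (- of_real c)
      - (LINT t|gamma_two. cauchy_kernel z t * cauchy_kernel (- of_real c) t))"
    using crit unfolding free_gamma_F_neg_real cauchy_moment_neg_real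
    by (simp add: right_diff_distrib flip: of_real_mult)
  also have "cauchy_moment 2 (- of_real c)
      - (LINT t|gamma_two. cauchy_kernel z t * cauchy_kernel (- of_real c) t)
    = (LINT t|gamma_two. cauchy_kernel (- of_real c) t ^ 2 - cauchy_kernel z t * cauchy_kernel (- of_real c) t)"
    unfolding cauchy_moment_def using int by simp
  also have "\<dots> = (LINT t|gamma_two. (z + of_real c) * ((1 / (c + t) ^ 2) *\<^sub>R cauchy_kernel z t))"
  proof (intro integral_cong_AE)
    show "AE t in gamma_two.
        cauchy_kernel (- of_real c) t ^ 2 - cauchy_kernel z t * cauchy_kernel (- of_real c) t
        = (z + of_real c) * ((1 / (c + t) ^ 2) *\<^sub>R cauchy_kernel z t)"
      using AE_gamma_two_nonneg
    proof eventually_elim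
      case (elim t)
      have "cauchy_kernel (- of_real c) t ^ 2 - cauchy_kernel z t * cauchy_kernel (- of_real c) t
        = (cauchy_kernel (- of_real c) t - cauchy_kernel z t) * cauchy_kernel (- of_real c) t"
        by (simp add: power2_eq_square algebra_simps)
      also have "\<dots> = (z + of_real c) * (cauchy_kernel (- of_real c) t ^ 2 * cauchy_kernel z t)"
        unfolding cauchy_kernel_diff[OF c' z elim] by (simp add: power2_eq_square)
      also have "\<dots> = (z + of_real c) * ((1 / (c + t) ^ 2) *\<^sub>R cauchy_kernel z t)"
        unfolding cauchy_kernel_neg_real by (simp add: power_divide scaleR_conv_of_real)
      finally show ?case .
    qed
  qed (auto simp: measurable_cong_sets[OF sets_gamma_two refl])
  also have "\<dots> = (z + of_real c) * (LINT t|gamma_two. (1 / (c + t) ^ 2) *\<^sub>R cauchy_kernel z t)"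
    by (rule integral_mult_right_zero)
  finally show ?thesis
    unfolding free_gamma_H_diff[OF z c'] by (simp add: power2_eq_square)
qed

section \<open>The boundary curve\<close>

context
  fixes \<alpha> c :: real
  assumes alpha: "\<alpha> > 0"
  defines "c \<equiv> free_gamma_c \<alpha>"
begin

lemma free_gamma_c_pos: "c > 0"
  and free_gamma_F_c: "free_gamma_F (- of_real c) = 1 / \<alpha>"
  unfolding c_def free_gamma_c_def using theI'[OF ex1_free_gamma_c[OF alpha]] by auto

text \<open>
  On a vertical half-line \<open>F\<close> decreases strictly to \<open>0\<close>, so only a small \<open>y\<close> with \<open>F \<ge> 1 / \<alpha>\<close>
  is needed. For \<open>x \<ge> 0\<close> it comes from the blow-up of \<open>F\<close>; for \<open>- c < x < 0\<close> from continuity, as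
  \<open>F x > F (- c)\<close>.
\<close>

lemma ex1_free_gamma_v:
  assumes x: "x > - c"
  shows "\<exists>!y. y > 0 \<and> free_gamma_F (Complex x y) = 1 / \<alpha>"
proof (rule ex_ex1I)
  obtain a where a: "a > 0" "free_gamma_F (Complex x a) \<ge> 1 / \<alpha>"
  proof (cases "x \<ge> 0")
    case True
    obtain d where "d > 0" "\<And>z. z \<notin> \<real>\<^sub>\<ge>\<^sub>0 \<Longrightarrow> cmod (z - of_real x) = d \<Longrightarrow> free_gamma_F z \<ge> 1 / \<alpha>"
      using ex_free_gamma_F_large[OF alpha True] by blast
    with that[of d] show thesis by (simp add: off_nonneg_Reals_iff cmod_def)
  next
    case False
    have "free_gamma_F (- of_real c) < free_gamma_F (- of_real (- x))"
      using False x by (intro free_gamma_F_neg_real_strict_antimono) auto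
    then have "1 / \<alpha> < free_gamma_F (Complex x 0)"
      by (simp add: free_gamma_F_c Complex_eq_of_real)
    moreover have "isCont (\<lambda>y. free_gamma_F (Complex x y)) 0"
      using False by (intro isCont_free_gamma_F_vertical) (simp add: off_nonneg_Reals_iff)
    ultimately have "\<forall>\<^sub>F y in at_right 0. 1 / \<alpha> < free_gamma_F (Complex x y)"
      unfolding isCont_def by (intro order_tendstoD(1)) (auto intro: tendsto_within_subset)
    then have "\<forall>\<^sub>F y in at_right 0. 0 < y \<and> 1 / \<alpha> < free_gamma_F (Complex x y)"
      using eventually_at_right_less by (rule eventually_conj[rotated])
    then obtain y where "0 < y" "1 / \<alpha> < free_gamma_F (Complex x y)"
      using eventually_happens'[OF trivial_limit_at_right_real] by blast
    with that show thesis by simp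
  qed
  \<comment> \<open>\<open>F z\<close> is at most the inverse square of the distance from \<open>z\<close> to the half-line, so distance
    \<open>sqrt \<alpha>\<close> is enough.\<close>
  define b where "b = max a (sqrt \<alpha>)"
  have b: "b \<ge> a" "b > 0" using a by (auto simp: b_def)
  have "free_gamma_F (Complex x b) \<le> 1 / b\<^sup>2"
  proof (rule free_gamma_F_le[OF b(2)])
    fix t :: real
    show "b \<le> cmod (Complex x b - of_real t)"
      using abs_Im_le_cmod[of "Complex x b - of_real t"] b(2) by simp
  qed
  also have "\<dots> \<le> 1 / \<alpha>"
  proof -
    have "(sqrt \<alpha>)\<^sup>2 \<le> b\<^sup>2" using alpha by (intro power_mono) (auto simp: b_def)
    then show ?thesis using alpha b(2) by (intro divide_left_mono) auto
  qed
  finally have Fb: "free_gamma_F (Complex x b) \<le> 1 / \<alpha>" .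
  have "\<exists>y\<ge>a. y \<le> b \<and> free_gamma_F (Complex x y) = 1 / \<alpha>"
  proof (rule IVT2[OF Fb a(2) b(1)], intro allI impI)
    fix y assume "a \<le> y \<and> y \<le> b"
    then show "isCont (\<lambda>y. free_gamma_F (Complex x y)) y"
      using a(1) by (intro isCont_free_gamma_F_vertical) (simp add: off_nonneg_Reals_iff)
  qed
  then obtain y where "a \<le> y" "free_gamma_F (Complex x y) = 1 / \<alpha>" by blast
  with a(1) show "\<exists>y>0. free_gamma_F (Complex x y) = 1 / \<alpha>"
    by (intro exI[of _ y]) auto
next
  fix y y' :: real
  assume *: "y > 0 \<and> free_gamma_F (Complex x y) = 1 / \<alpha>" "y' > 0 \<and> free_gamma_F (Complex x y') = 1 / \<alpha>"
  then have "Complex x y \<notin> \<real>\<^sub>\<ge>\<^sub>0" "Complex x y' \<notin> \<real>\<^sub>\<ge>\<^sub>0" by (auto simp: off_nonneg_Reals_iff)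
  with * show "y = y'"
    using free_gamma_F_vertical_strict_antimono[of x y y'] free_gamma_F_vertical_strict_antimono[of x y' y]
    by (cases y y' rule: linorder_cases) auto
qed

lemma free_gamma_v_pos: "x > - c \<Longrightarrow> free_gamma_v \<alpha> x > 0"
  and free_gamma_F_v: "x > - c \<Longrightarrow> free_gamma_F (Complex x (free_gamma_v \<alpha> x)) = 1 / \<alpha>"
  using theI'[OF ex1_free_gamma_v, of x] by (auto simp: free_gamma_v_def c_def)

lemma free_gamma_v_eq_0: "x \<le> - c \<Longrightarrow> free_gamma_v \<alpha> x = 0"
  by (simp add: free_gamma_v_def c_def)

lemma free_gamma_v_less_iff:
  assumes "x > - c" "y > 0"
  shows "free_gamma_v \<alpha> x < y \<longleftrightarrow> free_gamma_F (Complex x y) < 1 / \<alpha>"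
    and "y < free_gamma_v \<alpha> x \<longleftrightarrow> 1 / \<alpha> < free_gamma_F (Complex x y)"
proof -
  let ?v = "free_gamma_v \<alpha> x"
  have "Complex x y \<notin> \<real>\<^sub>\<ge>\<^sub>0" "Complex x ?v \<notin> \<real>\<^sub>\<ge>\<^sub>0"
    using assms free_gamma_v_pos[OF assms(1)] by (auto simp: off_nonneg_Reals_iff)
  note mono = free_gamma_F_vertical_strict_antimono[OF this(1), of ?v]
    free_gamma_F_vertical_strict_antimono[OF this(2), of y]
  show "?v < y \<longleftrightarrow> free_gamma_F (Complex x y) < 1 / \<alpha>"
    and "y < ?v \<longleftrightarrow> 1 / \<alpha> < free_gamma_F (Complex x y)"
    using mono free_gamma_F_v[OF assms(1)] free_gamma_v_pos[OF assms(1)] assms(2)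
    by (cases ?v y rule: linorder_cases; force)+
qed

text \<open>
  The point \<open>(- c, e)\<close> lies strictly above the level set for every \<open>e > 0\<close>, hence so does
  \<open>(x, e)\<close> for \<open>x\<close> near \<open>- c\<close>.
\<close>

lemma tendsto_free_gamma_v_edge: "(free_gamma_v \<alpha> \<longlongrightarrow> 0) (at_right (- c))"
proof (rule order_tendstoI)
  show "\<forall>\<^sub>F x in at_right (- c). a < free_gamma_v \<alpha> x" if "a < 0" for a
    using eventually_at_right_less by eventually_elim (use that free_gamma_v_pos in force)
  fix e :: real assume e: "0 < e"
  have "free_gamma_F (Complex (- c) e) < free_gamma_F (Complex (- c) 0)"
    using e free_gamma_c_pos by (intro free_gamma_F_vertical_strict_antimono) (auto simp: off_nonneg_Reals_iff)
  also have "\<dots> = 1 / \<alpha>"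
    using free_gamma_F_c by (simp add: Complex_eq_of_real)
  finally have "free_gamma_F (Complex (- c) e) < 1 / \<alpha>" .
  moreover have "isCont (\<lambda>x. free_gamma_F (Complex x e)) (- c)"
    using e by (intro isCont_free_gamma_F_horizontal) (simp add: off_nonneg_Reals_iff)
  ultimately have "\<forall>\<^sub>F x in at_right (- c). free_gamma_F (Complex x e) < 1 / \<alpha>"
    unfolding isCont_def by (intro order_tendstoD(2)) (auto intro: tendsto_within_subset)
  then show "\<forall>\<^sub>F x in at_right (- c). free_gamma_v \<alpha> x < e"
    using eventually_at_right_less by eventually_elim (use e in \<open>simp add: free_gamma_v_less_iff\<close>)
qed

lemma isCont_free_gamma_v:
  assumes x: "x > - c"
  shows "isCont (free_gamma_v \<alpha>) x"
  unfolding isCont_def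
proof (rule order_tendstoI)
  have ev: "\<forall>\<^sub>F w in at x. w > - c"
    using x by (intro order_tendstoD(1)[OF tendsto_ident_at])
  have cont: "((\<lambda>w. free_gamma_F (Complex w y)) \<longlongrightarrow> free_gamma_F (Complex x y)) (at x)" if "y > 0" for y
    using isCont_free_gamma_F_horizontal[of x y] that by (simp add: off_nonneg_Reals_iff isCont_def)
  show "\<forall>\<^sub>F w in at x. y < free_gamma_v \<alpha> w" if "y < free_gamma_v \<alpha> x" for y
  proof (cases "y > 0")
    case True
    have "1 / \<alpha> < free_gamma_F (Complex x y)" using free_gamma_v_less_iff[OF x True] that by simp
    from order_tendstoD(1)[OF cont[OF True] this] ev show ?thesis
      by eventually_elim (use True in \<open>simp add: free_gamma_v_less_iff\<close>)
  next
    case False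
    from ev show ?thesis by eventually_elim (use False free_gamma_v_pos in force)
  qed
  show "\<forall>\<^sub>F w in at x. free_gamma_v \<alpha> w < y" if "free_gamma_v \<alpha> x < y" for y
  proof -
    have y: "y > 0" using that free_gamma_v_pos[OF x] by simp
    have "free_gamma_F (Complex x y) < 1 / \<alpha>" using free_gamma_v_less_iff[OF x y] that by simp
    from order_tendstoD(2)[OF cont[OF y] this] ev show ?thesis
      by eventually_elim (use y in \<open>simp add: free_gamma_v_less_iff\<close>)
  qed
qed

lemma free_gamma_curve_off_nonneg_Reals: "Complex x (free_gamma_v \<alpha> x) \<notin> \<real>\<^sub>\<ge>\<^sub>0"
  using free_gamma_v_pos[of x] free_gamma_c_pos
  by (cases "x > - c") (auto simp: off_nonneg_Reals_iff c_def)

lemma free_gamma_F_curve_le: "free_gamma_F (Complex x (free_gamma_v \<alpha> x)) \<le> 1 / \<alpha>"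
proof (cases "x > - c")
  case True
  then show ?thesis using free_gamma_F_v by (simp add: c_def)
next
  case False
  then have v: "Complex x (free_gamma_v \<alpha> x) = - of_real (- x)"
    using free_gamma_v_eq_0[of x] by (simp add: c_def complex_eq_iff)
  show ?thesis
  proof (cases "x = - c")
    case True
    then show ?thesis
      using free_gamma_F_c unfolding v by (simp add: c_def)
  next
    case 2: False
    then show ?thesis
      using free_gamma_F_neg_real_strict_antimono[of c "- x"] free_gamma_F_c
        free_gamma_c_pos False unfolding v by (simp add: c_def)
  qed
qed

lemma free_gamma_H_curve:
  "free_gamma_H \<alpha> (Complex x (free_gamma_v \<alpha> x)) = of_real (free_gamma_P \<alpha> x)"
proof -
  have "Im (free_gamma_H \<alpha> (Complex x (free_gamma_v \<alpha> x))) = 0"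
    unfolding Im_free_gamma_H[OF free_gamma_curve_off_nonneg_Reals]
    using free_gamma_v_eq_0[of x] free_gamma_F_v[of x] alpha
    by (cases "x > - c") auto
  then show ?thesis by (simp add: free_gamma_P_def complex_eq_iff)
qed

text \<open>
  With \<open>z\<close>, \<open>w\<close> on the curve, \<open>P x' - P x = (z - w) B\<close> is real and \<open>Re B > 0\<close>. Multiplying by
  \<open>cnj B\<close> and taking real parts gives \<open>(P x' - P x) Re B = (x' - x) \<bar>B\<bar>\<^sup>2\<close>.
\<close>

lemma strict_mono_free_gamma_P: "strict_mono (free_gamma_P \<alpha>)"
proof (rule strict_monoI)
  fix x x' :: real assume less: "x < x'"
  define z where "z = Complex x' (free_gamma_v \<alpha> x')"
  define w where "w = Complex x (free_gamma_v \<alpha> x)"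
  define B where "B = 1 - of_real \<alpha> * (LINT t|gamma_two. cauchy_kernel z t * cauchy_kernel w t)"
  define d where "d = free_gamma_P \<alpha> x' - free_gamma_P \<alpha> x"
  have off: "z \<notin> \<real>\<^sub>\<ge>\<^sub>0" "w \<notin> \<real>\<^sub>\<ge>\<^sub>0"
    unfolding z_def w_def by (rule free_gamma_curve_off_nonneg_Reals)+
  have "z \<noteq> cnj w" using less by (simp add: z_def w_def complex_eq_iff)
  then have "Re (LINT t|gamma_two. cauchy_kernel z t * cauchy_kernel w t)
      < (free_gamma_F z + free_gamma_F w) / 2"
    by (rule Re_integral_kernel_product_less[OF off])
  also have "\<dots> \<le> 1 / \<alpha>"
    using free_gamma_F_curve_le[of x] free_gamma_F_curve_le[of x'] by (simp add: z_def w_def)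
  finally have "Re B > 0"
    using alpha by (simp add: B_def field_simps)
  have eq: "of_real d = (z - w) * B"
    using free_gamma_H_diff[OF off, of \<alpha>] by (simp add: d_def B_def z_def w_def free_gamma_H_curve)
  have "d * Re B = Re (of_real d * cnj B)" by simp
  also have "of_real d * cnj B = (z - w) * of_real ((cmod B)\<^sup>2)"
    unfolding eq complex_norm_square by (simp only: mult.assoc)
  also have "Re \<dots> = (x' - x) * (cmod B)\<^sup>2"
    by (simp add: z_def w_def)
  also have "\<dots> > 0"
    using less \<open>Re B > 0\<close> by (intro mult_pos_pos) auto
  finally have "d > 0"
    using \<open>Re B > 0\<close> by (simp add: zero_less_mult_iff)
  then show "free_gamma_P \<alpha> x < free_gamma_P \<alpha> x'" by (simp add: d_def)
qed

lemma tendsto_free_gamma_curve_edge: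
  "((\<lambda>x. Complex x (free_gamma_v \<alpha> x)) \<longlongrightarrow> - of_real c) (at_right (- c))"
proof -
  have "((\<lambda>x. Complex x (free_gamma_v \<alpha> x)) \<longlongrightarrow> Complex (- c) 0) (at_right (- c))"
    using tendsto_free_gamma_v_edge unfolding c_def
    by (intro tendsto_Complex tendsto_ident_at)
  then show ?thesis by (simp add: Complex_eq_of_real)
qed

lemma isCont_free_gamma_P:
  assumes "x > - c"
  shows "isCont (free_gamma_P \<alpha>) x"
proof -
  have "isCont (\<lambda>x. Complex x (free_gamma_v \<alpha> x)) x"
    using isCont_free_gamma_v[of x] assms unfolding isCont_def c_def
    by (intro tendsto_Complex tendsto_ident_at) auto
  from isCont_o2[OF this isCont_free_gamma_H[OF free_gamma_curve_off_nonneg_Reals]]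
  show ?thesis
    unfolding free_gamma_P_def[abs_def] by (intro isCont_Re)
qed

section \<open>Asymptotics at the edge\<close>

lemma tendsto_weighted_kernel_edge:
  fixes \<phi> :: "complex \<Rightarrow> 'b::{banach, second_countable_topology}"
  assumes "continuous_on UNIV \<phi>"
  shows "((\<lambda>x. LINT t|gamma_two. (1 / (c + t) ^ k) *\<^sub>R \<phi> (cauchy_kernel (Complex x (free_gamma_v \<alpha> x)) t))
    \<longlongrightarrow> (LINT t|gamma_two. (1 / (c + t) ^ k) *\<^sub>R \<phi> (of_real (- 1 / (c + t))))) (at_right (- c))"
proof -
  note c = free_gamma_c_pos
  have "isCont (\<lambda>w. LINT t|gamma_two. (1 / (c + t) ^ k) *\<^sub>R \<phi> (cauchy_kernel w t)) (- of_real c)"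
  proof (rule isCont_integral_weighted_kernel[OF neg_real_off_nonneg_Reals[OF c] assms])
    fix t :: real assume "t \<ge> 0"
    then show "\<bar>1 / (c + t) ^ k\<bar> \<le> 1 / c ^ k"
      using c by (auto intro!: divide_left_mono power_mono mult_pos_pos)
  qed measurable
  from isCont_tendsto_compose[OF this tendsto_free_gamma_curve_edge]
  show ?thesis by (simp add: cauchy_kernel_neg_real)
qed

lemma tendsto_free_gamma_v_squared_ratio:
  "((\<lambda>x. (free_gamma_v \<alpha> x)\<^sup>2 / (x + c)) \<longlongrightarrow> 2 * inverse_moment 3 c / inverse_moment 4 c)
    (at_right (- c))"
proof -
  note c = free_gamma_c_pos
  define \<zeta> where "\<zeta> x = Complex x (free_gamma_v \<alpha> x)" for x
  define A where "A k x = (LINT t|gamma_two. (1 / (c + t) ^ k) *\<^sub>R (cmod (cauchy_kernel (\<zeta> x) t))\<^sup>2)" for k x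
  have A_lim: "(A k \<longlongrightarrow> inverse_moment (k + 2) c) (at_right (- c))" for k
  proof -
    have "(1 / (c + t) ^ k) *\<^sub>R (cmod (of_real (- 1 / (c + t))))\<^sup>2 = 1 / (c + t) ^ (k + 2)" for t
      unfolding norm_of_real by (simp add: power_divide power_add power2_eq_square)
    then show ?thesis
      using tendsto_weighted_kernel_edge[of "\<lambda>w. (cmod w)\<^sup>2" k]
      unfolding A_def \<zeta>_def inverse_moment_def by (simp add: continuous_intros)
  qed
  have A_pos: "\<forall>\<^sub>F x in at_right (- c). A 2 x > 0"
    by (rule order_tendstoD(1)[OF A_lim inverse_moment_pos[OF c]])
  have "((\<lambda>x. 2 * A 1 x / A 2 x - (x + c)) \<longlongrightarrow>
      2 * inverse_moment (1 + 2) c / inverse_moment (2 + 2) c - (- c + c)) (at_right (- c))"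
    using inverse_moment_pos[OF c, of "2 + 2"] by (intro tendsto_intros A_lim) auto
  moreover have "\<forall>\<^sub>F x in at_right (- c). 2 * A 1 x / A 2 x - (x + c) = (free_gamma_v \<alpha> x)\<^sup>2 / (x + c)"
    using A_pos eventually_at_right_less
  proof eventually_elim
    case (elim x)
    have "0 = 2 * Re (\<zeta> x + of_real c) * A 1 x - (cmod (\<zeta> x + of_real c))\<^sup>2 * A 2 x"
      using free_gamma_F_expansion[OF free_gamma_curve_off_nonneg_Reals[of x] c]
        free_gamma_F_v[of x] free_gamma_F_c elim(2)
      unfolding A_def \<zeta>_def by (simp add: c_def)
    then have "((x + c)\<^sup>2 + (free_gamma_v \<alpha> x)\<^sup>2) * A 2 x = 2 * (x + c) * A 1 x"
      unfolding cmod_power2 \<zeta>_def by simp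
    then have "(x + c)\<^sup>2 + (free_gamma_v \<alpha> x)\<^sup>2 = (x + c) * (2 * A 1 x / A 2 x)"
      using elim(1) by (simp add: eq_divide_eq mult_ac)
    then have "(free_gamma_v \<alpha> x)\<^sup>2 = (x + c) * (2 * A 1 x / A 2 x - (x + c))"
      by (simp add: power2_eq_square algebra_simps)
    then show ?case using elim(2) by simp
  qed
  ultimately show ?thesis
    by (rule Lim_transform_eventually[THEN tendsto_eq_rhs]) (simp add: eval_nat_numeral)
qed

lemma tendsto_free_gamma_P_ratio:
  "((\<lambda>x. (free_gamma_P \<alpha> x - free_gamma_s \<alpha>) / (x + c))
    \<longlongrightarrow> \<alpha> * (2 * inverse_moment 3 c / inverse_moment 4 c) * inverse_moment 3 c) (at_right (- c))"
proof -
  note c = free_gamma_c_pos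
  define v where "v = free_gamma_v \<alpha>"
  define g where "g = 2 * inverse_moment 3 c / inverse_moment 4 c"
  have v_lim: "(v \<longlongrightarrow> 0) (at_right (- c))" "((\<lambda>x. (v x)\<^sup>2 / (x + c)) \<longlongrightarrow> g) (at_right (- c))"
    using tendsto_free_gamma_v_edge tendsto_free_gamma_v_squared_ratio
    by (simp_all add: v_def g_def c_def)
  define J where "J x = (LINT t|gamma_two. (1 / (c + t) ^ 2) *\<^sub>R cauchy_kernel (Complex x (v x)) t)" for x
  have J_lim: "(J \<longlongrightarrow> - of_real (inverse_moment 3 c)) (at_right (- c))"
  proof -
    have "(1 / (c + t) ^ 2) *\<^sub>R complex_of_real (- 1 / (c + t)) = - of_real (1 / (c + t) ^ 3)" for t
      unfolding scaleR_conv_of_real of_real_mult[symmetric] of_real_minus[symmetric]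
      by (simp add: eval_nat_numeral)
    then have "(LINT t|gamma_two. (1 / (c + t) ^ 2) *\<^sub>R complex_of_real (- 1 / (c + t)))
        = - of_real (inverse_moment 3 c)"
      unfolding inverse_moment_def by (simp only: integral_minus integral_complex_of_real)
    then show ?thesis
      using tendsto_weighted_kernel_edge[of "\<lambda>w. w" 2] unfolding J_def v_def by simp
  qed
  have "((\<lambda>x. Re (of_real \<alpha> * (of_real (x + c - (v x)\<^sup>2 / (x + c)) + 2 * \<i> * of_real (v x)) * J x))
    \<longlongrightarrow> Re (of_real \<alpha> * (of_real (- c + c - g)
          + 2 * \<i> * of_real 0) * (- of_real (inverse_moment 3 c)))) (at_right (- c))"
    by (intro tendsto_intros J_lim v_lim)
  moreover have "\<forall>\<^sub>F x in at_right (- c).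
      Re (of_real \<alpha> * (of_real (x + c - (v x)\<^sup>2 / (x + c)) + 2 * \<i> * of_real (v x)) * J x)
      = (free_gamma_P \<alpha> x - free_gamma_s \<alpha>) / (x + c)"
    using eventually_at_right_less
  proof eventually_elim
    case (elim x)
    have "Complex (- c) (v (- c)) = - of_real c"
      using free_gamma_v_eq_0[of "- c"] by (simp add: v_def c_def complex_eq_iff)
    then have "complex_of_real (free_gamma_P \<alpha> x - free_gamma_s \<alpha>)
        = free_gamma_H \<alpha> (Complex x (v x)) - free_gamma_H \<alpha> (- of_real c)"
      using free_gamma_H_curve[of x] free_gamma_H_curve[of "- c"]
      by (simp add: free_gamma_s_def v_def c_def)
    also have "\<dots> = of_real \<alpha> * (Complex x (v x) + of_real c)\<^sup>2 * J x"
      unfolding J_def using free_gamma_curve_off_nonneg_Reals[of x] c free_gamma_F_c alpha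
      by (intro free_gamma_H_expansion) (auto simp: v_def c_def)
    finally have "complex_of_real ((free_gamma_P \<alpha> x - free_gamma_s \<alpha>) / (x + c))
      = of_real \<alpha> * ((Complex x (v x) + of_real c)\<^sup>2 / of_real (x + c)) * J x"
      by simp
    also have "(Complex x (v x) + of_real c)\<^sup>2 / of_real (x + c)
      = of_real (x + c - (v x)\<^sup>2 / (x + c)) + 2 * \<i> * of_real (v x)"
    proof -
      define u where "u = x + c"
      have u: "u \<noteq> 0" using elim by (simp add: u_def)
      have "Complex x (v x) + of_real c = Complex u (v x)"
        by (simp add: u_def complex_eq_iff)
      moreover have "(Complex u (v x))\<^sup>2
          = of_real u * (of_real (u - (v x)\<^sup>2 / u) + 2 * \<i> * of_real (v x))"
        using u by (simp add: complex_eq_iff power2_eq_square right_diff_distrib)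
      ultimately show ?thesis
        using u by (simp add: u_def[symmetric])
    qed
    finally have "complex_of_real ((free_gamma_P \<alpha> x - free_gamma_s \<alpha>) / (x + c))
        = of_real \<alpha> * (of_real (x + c - (v x)\<^sup>2 / (x + c)) + 2 * \<i> * of_real (v x)) * J x" .
    from arg_cong[OF this[symmetric], of Re] show ?case
      unfolding Re_complex_of_real .
  qed
  ultimately show ?thesis
    by (rule Lim_transform_eventually[THEN tendsto_eq_rhs]) (simp add: g_def)
qed

text \<open>
  For \<open>\<xi>\<close> just above \<open>s\<close>, the intermediate value theorem on \<open>[- c, b]\<close> yields a preimage below
  \<open>b\<close>, and global injectivity of \<open>P\<close> makes it the value of the inverse.
\<close>

lemma filterlim_inv_free_gamma_P:
  "filterlim (inv (free_gamma_P \<alpha>)) (at_right (- c)) (at_right (free_gamma_s \<alpha>))"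
  and eventually_free_gamma_P_inv:
  "\<forall>\<^sub>F \<xi> in at_right (free_gamma_s \<alpha>). free_gamma_P \<alpha> (inv (free_gamma_P \<alpha>) \<xi>) = \<xi>"
proof -
  note less_iff = strict_mono_less[OF strict_mono_free_gamma_P]
  have s: "free_gamma_s \<alpha> = free_gamma_P \<alpha> (- c)" by (simp add: free_gamma_s_def c_def)
  have cont: "(free_gamma_P \<alpha> \<longlongrightarrow> free_gamma_P \<alpha> (- c)) (at_right (- c))"
  proof -
    have "((\<lambda>x. (free_gamma_P \<alpha> x - free_gamma_s \<alpha>) / (x + c) * (x + c) + free_gamma_s \<alpha>)
      \<longlongrightarrow> \<alpha> * (2 * inverse_moment 3 c / inverse_moment 4 c) * inverse_moment 3 c * (- c + c) + free_gamma_s \<alpha>)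
      (at_right (- c))"
      by (intro tendsto_intros tendsto_free_gamma_P_ratio)
    then show ?thesis
      unfolding s
      by (rule Lim_transform_eventually[THEN tendsto_eq_rhs])
        (use eventually_at_right_less[of "- c"] in \<open>auto elim!: eventually_mono\<close>)
  qed
  have preimage: "\<exists>x. - c < x \<and> x < b \<and> free_gamma_P \<alpha> x = \<xi>"
    if b: "- c < b" "free_gamma_s \<alpha> < \<xi>" "\<xi> < free_gamma_P \<alpha> b" for b \<xi>
  proof -
    have "continuous_on {- c..b} (free_gamma_P \<alpha>)"
      unfolding continuous_on_eq_continuous_within
    proof
      fix x assume x: "x \<in> {- c..b}"
      show "continuous (at x within {- c..b}) (free_gamma_P \<alpha>)"
      proof (cases "x = - c")
        case True
        then show ?thesis
          using cont b(1) by (simp add: continuous_within at_within_Icc_at_right)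
      next
        case False
        then show ?thesis
          using x isCont_free_gamma_P by (auto intro: continuous_at_imp_continuous_within)
      qed
    qed
    then obtain x where x: "- c \<le> x" "x \<le> b" "free_gamma_P \<alpha> x = \<xi>"
      using IVT'[of "free_gamma_P \<alpha>" "- c" \<xi> b] b unfolding s by auto
    have "- c < x" "x < b"
      using b(2,3) less_iff[of "- c" x] less_iff[of x b] unfolding s x(3) by simp_all
    with x(3) show ?thesis by blast
  qed
  have inv: "- c < inv (free_gamma_P \<alpha>) \<xi> \<and> inv (free_gamma_P \<alpha>) \<xi> < b \<and>
      free_gamma_P \<alpha> (inv (free_gamma_P \<alpha>) \<xi>) = \<xi>"
    if b: "- c < b" "free_gamma_s \<alpha> < \<xi>" "\<xi> < free_gamma_P \<alpha> b" for b \<xi>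
  proof -
    obtain x where x: "- c < x" "x < b" "free_gamma_P \<alpha> x = \<xi>"
      using preimage[OF b] by blast
    then have "inv (free_gamma_P \<alpha>) \<xi> = x"
      using inv_f_f[OF strict_mono_imp_inj_on[OF strict_mono_free_gamma_P]] by blast
    with x show ?thesis by simp
  qed
  have ev: "\<forall>\<^sub>F \<xi> in at_right (free_gamma_s \<alpha>). - c < inv (free_gamma_P \<alpha>) \<xi> \<and>
      inv (free_gamma_P \<alpha>) \<xi> < b \<and> free_gamma_P \<alpha> (inv (free_gamma_P \<alpha>) \<xi>) = \<xi>"
    if b: "- c < b" for b
  proof -
    have "free_gamma_s \<alpha> < free_gamma_P \<alpha> b"
      using b unfolding s by (simp add: less_iff)
    then show ?thesis
      unfolding eventually_at_right_field using inv[OF b] by blast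
  qed
  show "\<forall>\<^sub>F \<xi> in at_right (free_gamma_s \<alpha>). free_gamma_P \<alpha> (inv (free_gamma_P \<alpha>) \<xi>) = \<xi>"
    using ev[of "- c + 1"] by (auto elim: eventually_mono)
  show "filterlim (inv (free_gamma_P \<alpha>)) (at_right (- c)) (at_right (free_gamma_s \<alpha>))"
    unfolding filterlim_at
  proof (intro conjI order_tendstoI)
    have ev1: "\<forall>\<^sub>F \<xi> in at_right (free_gamma_s \<alpha>). - c < inv (free_gamma_P \<alpha>) \<xi>"
      using ev[of "- c + 1"] by (auto elim: eventually_mono)
    then show "\<forall>\<^sub>F \<xi> in at_right (free_gamma_s \<alpha>).
        inv (free_gamma_P \<alpha>) \<xi> \<in> {- c<..} \<and> inv (free_gamma_P \<alpha>) \<xi> \<noteq> - c"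
      by eventually_elim auto
    show "\<forall>\<^sub>F \<xi> in at_right (free_gamma_s \<alpha>). a < inv (free_gamma_P \<alpha>) \<xi>" if "a < - c" for a
      using ev1 by eventually_elim (use that in simp)
    show "\<forall>\<^sub>F \<xi> in at_right (free_gamma_s \<alpha>). inv (free_gamma_P \<alpha>) \<xi> < b" if "- c < b" for b
      using ev[OF that] by eventually_elim simp
  qed
qed

text \<open>
  Multiply the relation between the inverse moments by \<open>\<alpha>\<close> and insert \<open>\<alpha> M\<^sub>2 = 1\<close>.
\<close>

lemma free_gamma_s_minus_c_squared: "free_gamma_s \<alpha> - c\<^sup>2 = 2 * c\<^sup>2 * \<alpha> * inverse_moment 3 c"
proof -
  note c = free_gamma_c_pos
  have v: "Complex (- c) (free_gamma_v \<alpha> (- c)) = - of_real c"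
    using free_gamma_v_eq_0[of "- c"] by (simp add: c_def complex_eq_iff)
  have s: "free_gamma_s \<alpha> = - c + \<alpha> - \<alpha> * inverse_moment 1 c"
    unfolding free_gamma_s_def free_gamma_P_def c_def[symmetric] v free_gamma_H_eq cauchy_moment_neg_real
    by simp
  have crit: "\<alpha> * inverse_moment 2 c = 1"
    using free_gamma_F_c alpha unfolding free_gamma_F_neg_real by (simp add: c_def)
  have "\<alpha> - \<alpha> * inverse_moment 1 c - (c + c\<^sup>2) * (\<alpha> * inverse_moment 2 c) - 2 * c\<^sup>2 * \<alpha> * inverse_moment 3 c
    = \<alpha> * (1 - inverse_moment 1 c - (c + c\<^sup>2) * inverse_moment 2 c - 2 * c\<^sup>2 * inverse_moment 3 c)"
    by (simp add: algebra_simps)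
  also have "\<dots> = 0" using inverse_moment_relation[OF c] by simp
  finally show ?thesis unfolding crit s by simp
qed

lemma free_gamma_DH_2: "free_gamma_DH 2 \<alpha> = of_real (- 2 * \<alpha> * inverse_moment 3 c)"
  and free_gamma_DH_3: "free_gamma_DH 3 \<alpha> = of_real (- 6 * \<alpha> * inverse_moment 4 c)"
  and free_gamma_gamma_eq: "free_gamma_gamma \<alpha> = 2 * inverse_moment 3 c / inverse_moment 4 c"
proof -
  note c = free_gamma_c_pos
  show 2: "free_gamma_DH 2 \<alpha> = of_real (- 2 * \<alpha> * inverse_moment 3 c)"
    and 3: "free_gamma_DH 3 \<alpha> = of_real (- 6 * \<alpha> * inverse_moment 4 c)"
    unfolding free_gamma_DH_def c_def[symmetric]
      higher_derivs_free_gamma_H[OF neg_real_off_nonneg_Reals[OF c]] cauchy_moment_neg_real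
    by simp_all
  show "free_gamma_gamma \<alpha> = 2 * inverse_moment 3 c / inverse_moment 4 c"
    using alpha unfolding free_gamma_gamma_def 2 3
    by (simp flip: of_real_mult of_real_divide of_real_minus add: field_simps)
qed

lemma tendsto_free_gamma_v_ratio:
  "((\<lambda>x. free_gamma_v \<alpha> x / sqrt (x + c)) \<longlongrightarrow> sqrt (free_gamma_gamma \<alpha>)) (at_right (- c))"
proof -
  have "((\<lambda>x. sqrt ((free_gamma_v \<alpha> x)\<^sup>2 / (x + c))) \<longlongrightarrow> sqrt (free_gamma_gamma \<alpha>)) (at_right (- c))"
    unfolding free_gamma_gamma_eq by (intro tendsto_real_sqrt tendsto_free_gamma_v_squared_ratio)
  moreover have "\<forall>\<^sub>F x in at_right (- c). sqrt ((free_gamma_v \<alpha> x)\<^sup>2 / (x + c)) = free_gamma_v \<alpha> x / sqrt (x + c)"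
    using eventually_at_right_less
    by eventually_elim (use free_gamma_v_pos in \<open>force simp: real_sqrt_divide c_def\<close>)
  ultimately show ?thesis by (rule Lim_transform_eventually)
qed

text \<open>
  As a function of \<open>x\<close>, the inverse image of \<open>\<xi>\<close>, the quotient is \<open>R x\<close>: the factors
  \<open>sqrt (x + c)\<close> inserted in numerator and denominator make both converge.
\<close>

lemma free_gamma_density_edge:
  "((\<lambda>\<xi>. free_gamma_density \<alpha> \<xi> / sqrt (\<xi> - free_gamma_s \<alpha>))
    \<longlongrightarrow> sqrt 2 / (pi * c * sqrt (free_gamma_s \<alpha> - c\<^sup>2))) (at_right (free_gamma_s \<alpha>))"
proof -
  note c = free_gamma_c_pos
  note M = inverse_moment_pos[OF c]
  let ?\<gamma> = "free_gamma_gamma \<alpha>" and ?M = "inverse_moment 3 c" and ?s = "free_gamma_s \<alpha>"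
  have g: "?\<gamma> > 0" unfolding free_gamma_gamma_eq using M by simp
  define R where "R x = (1 / pi) * ((free_gamma_v \<alpha> x / sqrt (x + c)) / (x\<^sup>2 + (free_gamma_v \<alpha> x)\<^sup>2)
    / sqrt ((free_gamma_P \<alpha> x - ?s) / (x + c)))" for x
  have "(R \<longlongrightarrow> (1 / pi) * (sqrt ?\<gamma> / ((- c)\<^sup>2 + 0\<^sup>2) / sqrt (\<alpha> * ?\<gamma> * ?M))) (at_right (- c))"
    unfolding R_def
    using tendsto_free_gamma_v_edge c g alpha M[of 3] tendsto_free_gamma_P_ratio
    unfolding c_def[symmetric] free_gamma_gamma_eq[symmetric]
    by (intro tendsto_intros tendsto_free_gamma_v_ratio) auto
  also have "(1 / pi) * (sqrt ?\<gamma> / ((- c)\<^sup>2 + 0\<^sup>2) / sqrt (\<alpha> * ?\<gamma> * ?M)) = sqrt 2 / (pi * c * sqrt (?s - c\<^sup>2))"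
  proof -
    have "sqrt (?s - c\<^sup>2) = sqrt 2 * c * sqrt (\<alpha> * ?M)"
      unfolding free_gamma_s_minus_c_squared using c by (simp add: real_sqrt_mult)
    moreover have "sqrt (\<alpha> * ?\<gamma> * ?M) = sqrt ?\<gamma> * sqrt (\<alpha> * ?M)"
      by (simp add: real_sqrt_mult)
    ultimately show ?thesis
      using g c by (simp add: power2_eq_square)
  qed
  finally have "((\<lambda>\<xi>. R (inv (free_gamma_P \<alpha>) \<xi>)) \<longlongrightarrow> sqrt 2 / (pi * c * sqrt (?s - c\<^sup>2))) (at_right ?s)"
    by (rule filterlim_compose[OF _ filterlim_inv_free_gamma_P])
  moreover have "\<forall>\<^sub>F \<xi> in at_right ?s. R (inv (free_gamma_P \<alpha>) \<xi>) = free_gamma_density \<alpha> \<xi> / sqrt (\<xi> - ?s)"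
  proof -
    have "\<forall>\<^sub>F x in at_right (- c). - c < x" by (rule eventually_at_right_less)
    then have "\<forall>\<^sub>F \<xi> in at_right ?s. - c < inv (free_gamma_P \<alpha>) \<xi>"
      using filterlim_inv_free_gamma_P unfolding filterlim_iff by blast
    then show ?thesis
      using eventually_free_gamma_P_inv eventually_at_right_less
    proof eventually_elim
      case (elim \<xi>)
      then show ?case
        unfolding R_def free_gamma_density_def free_gamma_Q_def by (simp add: real_sqrt_divide)
    qed
  qed
  ultimately show ?thesis by (rule Lim_transform_eventually)
qed

end

theorem proposition4p3:
  fixes \<alpha> :: real
  assumes "\<alpha> > 0"
  shows "free_gamma_DH 2 \<alpha> \<in> \<real> \<and> free_gamma_DH 3 \<alpha> \<in> \<real> \<and> free_gamma_gamma \<alpha> > 0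
    \<and> free_gamma_v \<alpha> \<sim>[at_right (- free_gamma_c \<alpha>)]
        (\<lambda>x. sqrt (free_gamma_gamma \<alpha>) * sqrt (x + free_gamma_c \<alpha>))
    \<and> ((\<lambda>x. (free_gamma_P \<alpha> x - free_gamma_s \<alpha>) / (x + free_gamma_c \<alpha>))
         \<longlongrightarrow> - (1 / 2) * free_gamma_gamma \<alpha> * Re (free_gamma_DH 2 \<alpha>))
        (at_right (- free_gamma_c \<alpha>))
    \<and> - (1 / 2) * free_gamma_gamma \<alpha> * Re (free_gamma_DH 2 \<alpha>) > 0
    \<and> free_gamma_density \<alpha> \<sim>[at_right (free_gamma_s \<alpha>)]
        (\<lambda>\<xi>. sqrt 2 / (pi * free_gamma_c \<alpha> * sqrt (free_gamma_s \<alpha> - (free_gamma_c \<alpha>)\<^sup>2))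
               * sqrt (\<xi> - free_gamma_s \<alpha>))"
proof -
  define c where "c = free_gamma_c \<alpha>"
  have c: "c > 0" using free_gamma_c_pos[OF assms] by (simp add: c_def)
  note M = inverse_moment_pos[OF c]
  note DH = free_gamma_DH_2[OF assms, folded c_def] free_gamma_DH_3[OF assms, folded c_def]
  note \<gamma> = free_gamma_gamma_eq[OF assms, folded c_def]
  have \<gamma>_pos: "free_gamma_gamma \<alpha> > 0" unfolding \<gamma> using M by simp
  have slope: "- (1 / 2) * free_gamma_gamma \<alpha> * Re (free_gamma_DH 2 \<alpha>)
      = \<alpha> * (2 * inverse_moment 3 c / inverse_moment 4 c) * inverse_moment 3 c"
    unfolding DH \<gamma> Re_complex_of_real by simp
  have "free_gamma_v \<alpha> \<sim>[at_right (- c)] (\<lambda>x. sqrt (free_gamma_gamma \<alpha>) * sqrt (x + c))"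
  proof (rule asymp_equivI')
    have "((\<lambda>x. free_gamma_v \<alpha> x / sqrt (x + c) / sqrt (free_gamma_gamma \<alpha>))
        \<longlongrightarrow> sqrt (free_gamma_gamma \<alpha>) / sqrt (free_gamma_gamma \<alpha>)) (at_right (- c))"
      using \<gamma>_pos by (intro tendsto_intros tendsto_free_gamma_v_ratio[OF assms, folded c_def]) auto
    then show "((\<lambda>x. free_gamma_v \<alpha> x / (sqrt (free_gamma_gamma \<alpha>) * sqrt (x + c))) \<longlongrightarrow> 1) (at_right (- c))"
      using \<gamma>_pos by (simp add: mult.commute)
  qed
  moreover have "free_gamma_density \<alpha> \<sim>[at_right (free_gamma_s \<alpha>)]
      (\<lambda>\<xi>. sqrt 2 / (pi * c * sqrt (free_gamma_s \<alpha> - c\<^sup>2)) * sqrt (\<xi> - free_gamma_s \<alpha>))"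
  proof (rule asymp_equivI')
    define K where "K = sqrt 2 / (pi * c * sqrt (free_gamma_s \<alpha> - c\<^sup>2))"
    have K: "K \<noteq> 0"
      unfolding K_def free_gamma_s_minus_c_squared[OF assms, folded c_def] using c assms M[of 3] by simp
    have "((\<lambda>\<xi>. free_gamma_density \<alpha> \<xi> / sqrt (\<xi> - free_gamma_s \<alpha>) / K) \<longlongrightarrow> K / K) (at_right (free_gamma_s \<alpha>))"
      using free_gamma_density_edge[OF assms, folded c_def] K unfolding K_def[symmetric]
      by (intro tendsto_intros) auto
    then show "((\<lambda>\<xi>. free_gamma_density \<alpha> \<xi> / (K * sqrt (\<xi> - free_gamma_s \<alpha>))) \<longlongrightarrow> 1) (at_right (free_gamma_s \<alpha>))"
      using K by (simp add: mult.commute)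
  qed
  moreover have "- (1 / 2) * free_gamma_gamma \<alpha> * Re (free_gamma_DH 2 \<alpha>) > 0"
    unfolding slope using assms M by simp
  moreover have "((\<lambda>x. (free_gamma_P \<alpha> x - free_gamma_s \<alpha>) / (x + c))
      \<longlongrightarrow> - (1 / 2) * free_gamma_gamma \<alpha> * Re (free_gamma_DH 2 \<alpha>)) (at_right (- c))"
    unfolding slope by (rule tendsto_free_gamma_P_ratio[OF assms, folded c_def])
  ultimately show ?thesis
    using \<gamma>_pos unfolding c_def[symmetric] by (simp add: DH)
qed

end
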